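(* Assume that $q$ is not a root of unity. Then the elements $\Omega^\ell\alpha^r\beta^s\gamma^t$ with $\ell,r,s,t\geq 0$ form a basis for the $\mathbb F$-vector space $Z(\Delta)$, the center of $\Delta$.
   Context: Let $\mathbb F$ be a field and fix a nonzero $q\in\mathbb F$ with $q^4\neq 1$. The universal Askey--Wilson algebra $\Delta$ is the associative $\mathbb F$-algebra with 1 with generators $A,B,C$ subject to the relations that each of $A+\frac{qBC-q^{-1}CB}{q^2-q^{-2}}$, $B+\frac{qCA-q^{-1}AC}{q^2-q^{-2}}$, $C+\frac{qAB-q^{-1}BA}{q^2-q^{-2}}$ is central; $\alpha,\beta,\gamma$ denote these three central elements (in order) each multiplied by $q+q^{-1}$. Let $\Omega = qABC+q^2A^2+q^{-2}B^2+q^2C^2-qA\alpha-q^{-1}B\beta-qC\gamma$. *)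

theory Defs
  imports Main
begin

text \<open>Free associative algebra on three generators A, B, C over a field:
  elements are coefficient functions on words (lists of generators);
  polynomials are those with finite support.\<close>

datatype gen = GA | GB | GC

type_synonym 'a nc = "gen list \<Rightarrow> 'a"

definition ncpolys :: "('a::zero) nc set" where
  "ncpolys = {f. finite {w. f w \<noteq> 0}}"

definition ncadd :: "('a::comm_ring_1) nc \<Rightarrow> 'a nc \<Rightarrow> 'a nc" where
  "ncadd f g = (\<lambda>w. f w + g w)"

definition ncsub :: "('a::comm_ring_1) nc \<Rightarrow> 'a nc \<Rightarrow> 'a nc" where
  "ncsub f g = (\<lambda>w. f w - g w)"

definition ncsmul :: "'a::comm_ring_1 \<Rightarrow> 'a nc \<Rightarrow> 'a nc" where
  "ncsmul c f = (\<lambda>w. c * f w)"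

definition ncmul :: "('a::comm_ring_1) nc \<Rightarrow> 'a nc \<Rightarrow> 'a nc" where
  "ncmul f g = (\<lambda>w. \<Sum>i\<le>length w. f (take i w) * g (drop i w))"

definition ncone :: "('a::comm_ring_1) nc" where
  "ncone = (\<lambda>w. if w = [] then 1 else 0)"

definition ncgen :: "gen \<Rightarrow> ('a::comm_ring_1) nc" where
  "ncgen x = (\<lambda>w. if w = [x] then 1 else 0)"

definition ncpow :: "('a::comm_ring_1) nc \<Rightarrow> nat \<Rightarrow> 'a nc" where
  "ncpow f n = ((ncmul f) ^^ n) ncone"

abbreviation "gA \<equiv> ncgen GA"
abbreviation "gB \<equiv> ncgen GB"
abbreviation "gC \<equiv> ncgen GC"

definition aw_cen :: "'a::field \<Rightarrow> 'a nc \<Rightarrow> 'a nc \<Rightarrow> 'a nc \<Rightarrow> 'a nc" where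
  "aw_cen q X Y Z = ncadd X (ncsmul (inverse (q^2 - (inverse q)^2))
        (ncsub (ncsmul q (ncmul Y Z)) (ncsmul (inverse q) (ncmul Z Y))))"

definition aw_alpha :: "'a::field \<Rightarrow> 'a nc" where
  "aw_alpha q = ncsmul (q + inverse q) (aw_cen q gA gB gC)"
definition aw_beta :: "'a::field \<Rightarrow> 'a nc" where
  "aw_beta q = ncsmul (q + inverse q) (aw_cen q gB gC gA)"
definition aw_gamma :: "'a::field \<Rightarrow> 'a nc" where
  "aw_gamma q = ncsmul (q + inverse q) (aw_cen q gC gA gB)"

definition aw_rels :: "'a::field \<Rightarrow> 'a nc set" where
  "aw_rels q = {ncsub (ncmul X g) (ncmul g X) | X g.
      X \<in> {aw_cen q gA gB gC, aw_cen q gB gC gA, aw_cen q gC gA gB} \<and> g \<in> {gA, gB, gC}}"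

inductive_set aw_ideal :: "'a::field \<Rightarrow> 'a nc set" for q :: 'a where
  zero: "(\<lambda>w. 0) \<in> aw_ideal q"
| gen: "r \<in> aw_rels q \<Longrightarrow> u \<in> ncpolys \<Longrightarrow> v \<in> ncpolys \<Longrightarrow> ncmul (ncmul u r) v \<in> aw_ideal q"
| add: "x \<in> aw_ideal q \<Longrightarrow> y \<in> aw_ideal q \<Longrightarrow> ncadd x y \<in> aw_ideal q"

text \<open>x (a polynomial) represents an element of the center Z(Delta).\<close>
definition aw_central :: "'a::field \<Rightarrow> 'a nc \<Rightarrow> bool" where
  "aw_central q x \<longleftrightarrow> x \<in> ncpolys \<and>
     (\<forall>y\<in>ncpolys. ncsub (ncmul x y) (ncmul y x) \<in> aw_ideal q)"

definition aw_Omega :: "'a::field \<Rightarrow> 'a nc" where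
  "aw_Omega q =
    ncsub (ncsub (ncsub
      (ncadd (ncadd (ncadd (ncsmul q (ncmul (ncmul gA gB) gC))
                           (ncsmul (q^2) (ncmul gA gA)))
                    (ncsmul ((inverse q)^2) (ncmul gB gB)))
             (ncsmul (q^2) (ncmul gC gC)))
      (ncsmul q (ncmul gA (aw_alpha q))))
      (ncsmul (inverse q) (ncmul gB (aw_beta q))))
      (ncsmul q (ncmul gC (aw_gamma q)))"

definition aw_mon :: "'a::field \<Rightarrow> nat \<times> nat \<times> nat \<times> nat \<Rightarrow> 'a nc" where
  "aw_mon q k = (case k of (l, r, s, t) \<Rightarrow>
     ncmul (ncmul (ncmul (ncpow (aw_Omega q) l) (ncpow (aw_alpha q) r))
                  (ncpow (aw_beta q) s)) (ncpow (aw_gamma q) t))"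

definition aw_lincomb :: "'a::field \<Rightarrow> (nat \<times> nat \<times> nat \<times> nat \<Rightarrow> 'a)
     \<Rightarrow> (nat \<times> nat \<times> nat \<times> nat) set \<Rightarrow> 'a nc" where
  "aw_lincomb q c S = (\<lambda>w. \<Sum>k\<in>S. c k * aw_mon q k w)"

end

theory Submission
  imports Defs "HOL-Library.Poly_Mapping" "HOL-Library.Product_Plus"
begin

text \<open>
  Over the polynomial ring $R = F[\alpha,\beta,\gamma]$, the algebra has the PBW basis
  $A^i B^j C^k$: the relations rewrite $BA$, $CA$ and $CB$, and the only overlap to resolve is $CBA$.
  Filter by the degree $i+j+k$, with scalars in $R$ having degree 0. The associated graded algebra is a
  quantum polynomial ring whose generators commute up to $q^{\pm 2}$, so if $q$ is not a root of
  unity its centre is spanned over $R$ by the powers of $ABC$. The Casimir element $\Omega$ has leading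
  term $qABC$. Hence the leading term of a central element is that of an $R$-multiple of some $\Omega^n$;
  subtracting it and inducting on the degree gives spanning, and the distinct degrees $3n$ of
  the $\Omega^n$ give linear independence.

  The PBW basis is obtained from a left module: the free $R$-module on triples $(i,j,k)$ carries
  operators $A$, $B$, $C$ satisfying the relations, and sending a triple to $A^i B^j C^k$ inverts
  the map $x \mapsto x \cdot 1$ modulo the ideal.
\<close>

section \<open>Finitely supported functions\<close>

text \<open>The module replaces a confluence argument: instead of showing that all reductions of a
  word agree, operators obeying the relations are constructed, and evaluation at \<open>1\<close>
  reads off coordinates. The relations are used with denominators cleared, CB = q^2 BC - (q^2 -
  1)\<alpha> + (q^3 - q^(-1))A and likewise for BA; for CA the two generators occur in the opposite
  order, whence the powers of q^(-1). In this form only an inverse \<open>p\<close> of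
  \<open>q\<close> is required, so the module lives over any commutative ring; the field returns
  when these relations are compared with those of \<Delta>, which divide by q^2 - q^(-2).

  A top monomial A^i B^j C^k of a central element is located by two comparisons: commuting with A
  gives q^(2j) = q^(2k), commuting with B gives q^(2i) = q^(2k). The infinite order of q turns these
  into i = j = k.\<close>

definition sum_extend :: "('k \<Rightarrow> 'b::zero \<Rightarrow> 'c::comm_monoid_add) \<Rightarrow> ('k \<Rightarrow>\<^sub>0 'b) \<Rightarrow> 'c" where
  "sum_extend f v = (\<Sum>m\<in>Poly_Mapping.keys v. f m (Poly_Mapping.lookup v m))"

lemma sum_extend_single: "f m 0 = 0 \<Longrightarrow> sum_extend f (Poly_Mapping.single m r) = f m r"
  by (simp add: sum_extend_def)

lemma sum_extend_zero [simp]: "sum_extend f 0 = 0"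
  by (simp add: sum_extend_def)

text \<open>Additivity in the coefficient is all that \<open>lin\<close>, \<open>rho\<close>,
  \<open>lift_scalar\<close>, \<open>lift\<close> and \<open>omega_sum\<close> have to supply.
  Passing the coefficient to \<open>f\<close> lets the target be a different algebra, with scalars
  on either side.\<close>

lemma sum_extend_add:
  fixes v w :: "'k \<Rightarrow>\<^sub>0 'b::comm_monoid_add"
  assumes "\<And>m. f m 0 = 0" "\<And>m x y. f m (x + y) = f m x + f m y"
  shows "sum_extend f (v + w) = sum_extend f v + sum_extend f w"
  unfolding sum_extend_def by (rule setsum_keys_plus_distrib) (use assms in auto)

text \<open>The \<open>add\<close> case asks nothing about supports, which suits statements that are
  closed under sums.\<close>

lemma poly_mapping_single_add_induct [case_names single add]:
  fixes v :: "'k \<Rightarrow>\<^sub>0 'b::comm_monoid_add"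
  assumes single: "\<And>m r. P (Poly_Mapping.single m r)"
    and add: "\<And>v w. P v \<Longrightarrow> P w \<Longrightarrow> P (v + w)"
  shows "P v"
proof -
  have v: "v = (\<Sum>m\<in>Poly_Mapping.keys v. Poly_Mapping.single m (Poly_Mapping.lookup v m))"
    by (rule poly_mapping_eqI)
      (auto simp: lookup_sum lookup_single when_def in_keys_iff)
  have "P (\<Sum>m\<in>M. Poly_Mapping.single m (Poly_Mapping.lookup v m))" if "finite M" for M
    using that
  proof induction
    case empty
    \<comment> \<open>The empty sum is an entry with coefficient 0, at any key.\<close>
    show ?case using single[of undefined 0] by simp
  next
    case (insert m M)
    then show ?case by (simp add: single add)
  qed
  then show ?thesis using v by (metis finite_keys)
qed

text \<open>Quantified exponents stay whole triples, as the facts about \<open>deg\<close> and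
  \<open>lead\<close> expect them.\<close>

declare split_paired_All [simp del]

section \<open>Scalars and monomials\<close>

type_synonym idx = "nat \<times> nat \<times> nat"

text \<open>Scalars are embedded as constants, so that scalar multiplication is ring multiplication
  and \<open>algebra_simps\<close> applies. The same \<open>con\<close> serves R, the module and the
  free algebra.\<close>

definition con :: "'r \<Rightarrow> ('k::zero \<Rightarrow>\<^sub>0 'r::zero)" where
  "con r = Poly_Mapping.single 0 r"

definition mon :: "'k \<Rightarrow> ('k \<Rightarrow>\<^sub>0 'r::zero_neq_one)" where
  "mon m = Poly_Mapping.single m 1"

lemma con_zero [simp]: "con 0 = 0" by (simp add: con_def)
lemma con_one [simp]: "con 1 = 1" by (simp add: con_def)
lemma con_add: "con (r + s) = con r + con s" by (simp add: con_def single_add)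
lemma con_diff: "con (r - s) = con r - con (s::'r::ab_group_add)" by (simp add: con_def single_diff)
lemma con_uminus: "con (- s) = - con (s::'r::ab_group_add)" by (simp add: con_def single_uminus)
lemma con_mult: "con (r * s) = con r * (con s :: 'k::monoid_add \<Rightarrow>\<^sub>0 'r::semiring_1)"
  by (simp add: con_def mult_single)
lemma con_power: "con (r ^ n) = (con r :: 'k::monoid_add \<Rightarrow>\<^sub>0 'r::semiring_1) ^ n"
  by (induction n) (simp_all add: con_mult)
lemma mon_zero [simp]: "mon 0 = 1" by (simp add: mon_def)
lemma mon_mult: "mon m * mon n = (mon (m + n) :: 'k::monoid_add \<Rightarrow>\<^sub>0 'r::semiring_1)"
  by (simp add: mon_def mult_single)
lemma con_mult_mon: "con r * mon m = (Poly_Mapping.single m r :: 'k::monoid_add \<Rightarrow>\<^sub>0 'r::semiring_1)"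
  by (simp add: mon_def con_def mult_single)

lemmas con_simps = con_add con_diff con_uminus con_mult con_power

lemma con_mon_induct [case_names mon add]:
  fixes v :: "'k::monoid_add \<Rightarrow>\<^sub>0 'r::semiring_1"
  assumes "\<And>m r. P (con r * mon m)" "\<And>v w. P v \<Longrightarrow> P w \<Longrightarrow> P (v + w)"
  shows "P v"
  using assms by (induction v rule: poly_mapping_single_add_induct) (auto simp: con_mult_mon)

lemma lookup_mon_mult:
  fixes v :: "'k::cancel_comm_monoid_add \<Rightarrow>\<^sub>0 'r::comm_ring_1"
  shows "Poly_Mapping.lookup (mon n * v) (n + m) = Poly_Mapping.lookup v m"
proof (induction v rule: con_mon_induct)
  case (mon k r)
  have "mon n * (con r * mon k) = (con r * mon (n + k) :: 'k \<Rightarrow>\<^sub>0 'r)"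
    by (simp add: mon_mult[symmetric] mult_ac)
  then show ?case by (simp add: con_mult_mon lookup_single when_def)
qed (simp add: lookup_add algebra_simps)

lemma lookup_con_mult:
  fixes v :: "'k::cancel_comm_monoid_add \<Rightarrow>\<^sub>0 'r::comm_ring_1"
  shows "Poly_Mapping.lookup (con r * v) m = r * Poly_Mapping.lookup v m"
  by (induction v rule: poly_mapping_single_add_induct)
     (simp_all add: con_def mult_single lookup_add lookup_single when_def algebra_simps)

definition lin :: "(idx \<Rightarrow> (idx \<Rightarrow>\<^sub>0 'r)) \<Rightarrow> (idx \<Rightarrow>\<^sub>0 'r::comm_ring_1) \<Rightarrow> (idx \<Rightarrow>\<^sub>0 'r)" where
  "lin f = sum_extend (\<lambda>m r. con r * f m)"

lemma lin_zero [simp]: "lin f 0 = 0"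
  by (simp add: lin_def)

lemma lin_add: "lin f (v + w) = lin f v + lin f w"
  unfolding lin_def by (rule sum_extend_add) (simp_all add: con_add algebra_simps)

lemma lin_con_mon: "lin f (con r * mon m) = con r * f m"
  by (simp add: lin_def con_mult_mon sum_extend_single)

lemma lin_mon [simp]: "lin f (mon m) = f m"
  using lin_con_mon[of f 1 m] by simp

lemma lin_con: "lin f (con r * v) = con r * lin f v"
proof (induction v rule: con_mon_induct)
  case (mon m s)
  show ?case using lin_con_mon[of f "r * s" m] by (simp add: con_mult lin_con_mon mult_ac)
qed (simp add: lin_add algebra_simps)

lemma lin_uminus: "lin f (- v) = - lin f v"
  using lin_add[of f v "- v"] by (simp add: eq_neg_iff_add_eq_0 add.commute)

lemma lin_diff: "lin f (v - w) = lin f v - lin f w"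
  using lin_add[of f v "- w"] by (simp add: lin_uminus)

lemma lin_cong: "(\<And>m. m \<in> Poly_Mapping.keys v \<Longrightarrow> f m = g m) \<Longrightarrow> lin f v = lin g v"
  by (simp add: lin_def sum_extend_def)

lemma lin_expand: "lin f v = (\<Sum>m\<in>Poly_Mapping.keys v. con (Poly_Mapping.lookup v m) * f m)"
  by (simp add: lin_def sum_extend_def)

section \<open>The degree filtration\<close>

fun deg :: "idx \<Rightarrow> nat" where "deg (i, j, k) = i + j + k"

lemma deg_add: "deg (m + n) = deg m + deg n"
  by (cases m; cases n) simp

text \<open>Elements of degree strictly less than \<open>d\<close>, so that \<open>low 0\<close> contains only 0.\<close>

definition low :: "nat \<Rightarrow> (idx \<Rightarrow>\<^sub>0 'r::comm_ring_1) set" where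
  "low d = {v. \<forall>m\<in>Poly_Mapping.keys v. deg m < d}"

lemma low_zero [simp]: "0 \<in> low d" by (simp add: low_def)
lemma low_lookup: "v \<in> low d \<Longrightarrow> d \<le> deg m \<Longrightarrow> Poly_Mapping.lookup v m = 0"
  by (metis (mono_tags, lifting) in_keys_iff leD low_def mem_Collect_eq)
lemma low_0: "v \<in> low 0 \<longleftrightarrow> v = 0"
  by (metis le0 low_lookup low_zero lookup_zero poly_mapping_eqI)
lemma lowI:
  assumes "\<And>m. d \<le> deg m \<Longrightarrow> Poly_Mapping.lookup v m = 0"
  shows "v \<in> low d"
  unfolding low_def mem_Collect_eq using assms by (metis in_keys_iff not_le)
lemma low_add: "v \<in> low d \<Longrightarrow> w \<in> low d \<Longrightarrow> v + w \<in> low d"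
  by (rule lowI) (simp add: low_lookup lookup_add)
lemma low_diff: "v \<in> low d \<Longrightarrow> w \<in> low d \<Longrightarrow> v - w \<in> low d"
  by (rule lowI) (simp add: low_lookup lookup_minus)
lemma low_con: "v \<in> low d \<Longrightarrow> con r * v \<in> low d"
  by (rule lowI) (simp add: low_lookup lookup_con_mult)
lemma low_mono: "v \<in> low d \<Longrightarrow> d \<le> e \<Longrightarrow> v \<in> low e"
  by (rule lowI) (simp add: low_lookup)
lemma low_mon: "deg m < d \<Longrightarrow> mon m \<in> low d"
  by (simp add: low_def mon_def)
lemma low_sum: "(\<And>x. x \<in> X \<Longrightarrow> f x \<in> low d) \<Longrightarrow> sum f X \<in> low d"
  by (induction X rule: infinite_finite_induct) (auto simp: low_add)
lemma low_mon_mult: "v \<in> low d \<Longrightarrow> mon m * v \<in> low (d + deg m)"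
  unfolding low_def using keys_mult[of "mon m" v]
  by (fastforce simp: mon_def deg_add)
lemma low_lin: "(\<And>m. m \<in> Poly_Mapping.keys v \<Longrightarrow> f m \<in> low d) \<Longrightarrow> lin f v \<in> low d"
  unfolding lin_expand by (intro low_sum low_con)
lemma low_exists: "\<exists>d. v \<in> low d"
proof -
  have "deg m < Suc (Max (deg ` Poly_Mapping.keys v))" if "m \<in> Poly_Mapping.keys v" for m
    using that by (simp add: less_Suc_eq_le)
  then show ?thesis unfolding low_def by blast
qed

text \<open>The map \<open>f\<close> multiplies basis elements by the monomial \<open>n\<close> up to the scalars \<open>t\<close> and terms of lower degree.\<close>

definition lead :: "(idx \<Rightarrow> (idx \<Rightarrow>\<^sub>0 'r::comm_ring_1)) \<Rightarrow> (idx \<Rightarrow> 'r) \<Rightarrow> idx \<Rightarrow> bool" where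
  "lead f t n \<longleftrightarrow> (\<forall>m. f m - con (t m) * mon (m + n) \<in> low (deg m + deg n))"

lemma leadI:
  assumes "\<And>i j k. f (i, j, k) - con (t (i, j, k)) * mon ((i, j, k) + n) \<in> low (i + j + k + deg n)"
  shows "lead f t n"
  unfolding lead_def using assms by (metis deg.simps prod_cases3)

text \<open>Adding \<open>n\<close> to exponents is injective, so no two basis elements
  collide.\<close>

lemma lookup_lin_shift:
  "Poly_Mapping.lookup (lin (\<lambda>m. con (t m) * mon (m + n)) v) (m + n) = t m * Poly_Mapping.lookup v m"
proof (induction v rule: con_mon_induct)
  case (mon l r)
  have eq: "lin (\<lambda>m. con (t m) * mon (m + n)) (con r * mon l) = con (r * t l) * mon (l + n)"
    by (simp add: lin_con_mon con_mult mult.assoc)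
  show ?case
    unfolding eq by (simp add: con_mult_mon lookup_single when_def mult.commute[of r])
qed (simp add: lin_add lookup_add algebra_simps)

text \<open>When \<open>v\<close> has degree at most \<open>deg m\<close>, every error term of
  \<open>f\<close> lands strictly below the degree of \<open>m + n\<close>, so only the coefficient
  of \<open>v\<close> at \<open>m\<close> contributes there.\<close>

lemma lookup_lead:
  assumes "lead f t n" "v \<in> low (Suc (deg m))"
  shows "Poly_Mapping.lookup (lin f v) (m + n) = t m * Poly_Mapping.lookup v m"
proof -
  have "lin f v - lin (\<lambda>m. con (t m) * mon (m + n)) v = lin (\<lambda>m. f m - con (t m) * mon (m + n)) v"
    by (simp add: lin_expand sum_subtractf algebra_simps)
  also have "\<dots> \<in> low (deg m + deg n)"
  proof (rule low_lin)
    fix l assume "l \<in> Poly_Mapping.keys v"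
    then have "deg l \<le> deg m" using assms(2) by (auto simp: low_def)
    then show "f l - con (t l) * mon (l + n) \<in> low (deg m + deg n)"
      using assms(1) low_mono by (metis add_le_mono1 lead_def)
  qed
  finally have "Poly_Mapping.lookup (lin f v - lin (\<lambda>m. con (t m) * mon (m + n)) v) (m + n) = 0"
    by (rule low_lookup) (simp add: deg_add)
  then show ?thesis by (simp add: lookup_minus lookup_lin_shift)
qed

section \<open>The PBW module\<close>

locale aw_scalars =
  fixes q p al be ga :: "'r::comm_ring_1"
  assumes qp: "q * p = 1"
begin

definition A :: "(idx \<Rightarrow>\<^sub>0 'r) \<Rightarrow> (idx \<Rightarrow>\<^sub>0 'r)" where "A v = mon (1, 0, 0) * v"

text \<open>The operators \<open>B\<close> and \<open>C\<close> are determined on basis elements by moving \<open>B\<close> past \<open>A\<close> and \<open>C\<close> past \<open>A\<close>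
  and \<open>B\<close>. Computing \<open>C B\<^sup>j C\<^sup>k\<close> needs \<open>B\<close> on arbitrary elements of the same degree, so this is not a structural
  recursion; instead one step maps approximations that are correct below degree \<open>d\<close> to
  approximations correct below degree \<open>d + 1\<close>, and \<open>(B, C)\<close> is the fixed point.\<close>

fun stepB :: "(idx \<Rightarrow> (idx \<Rightarrow>\<^sub>0 'r)) \<Rightarrow> (idx \<Rightarrow> (idx \<Rightarrow>\<^sub>0 'r)) \<Rightarrow> idx \<Rightarrow> (idx \<Rightarrow>\<^sub>0 'r)" where
  "stepB f g (0, j, k) = mon (0, Suc j, k)"
| "stepB f g (Suc i, j, k) = con (q^2) * A (f (i, j, k)) - con ((q^2 - 1) * ga) * mon (i, j, k)
     + con (q^3 - p) * g (i, j, k)"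

text \<open>The part of \<open>C B\<^sup>j C\<^sup>k\<close> below its leading term \<open>q\<^bsup>2j\<^esup> B\<^sup>j C\<^bsup>k+1\<^esup>\<close>.\<close>

fun tailC :: "(idx \<Rightarrow> (idx \<Rightarrow>\<^sub>0 'r)) \<Rightarrow> nat \<Rightarrow> nat \<Rightarrow> (idx \<Rightarrow>\<^sub>0 'r)" where
  "tailC h 0 k = 0"
| "tailC h (Suc j) k = con (q^2) * lin h (tailC h j k) - con ((q^2 - 1) * al) * mon (0, j, k)
     + con (q^3 - p) * mon (1, j, k)"

fun stepC :: "(idx \<Rightarrow> (idx \<Rightarrow>\<^sub>0 'r)) \<Rightarrow> (idx \<Rightarrow> (idx \<Rightarrow>\<^sub>0 'r)) \<Rightarrow> idx \<Rightarrow> (idx \<Rightarrow>\<^sub>0 'r)" where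
  "stepC f g (0, j, k) = con (q^(2*j)) * mon (0, j, Suc k) + tailC (stepB f g) j k"
| "stepC f g (Suc i, j, k) = con (p^2) * A (g (i, j, k)) + con ((1 - p^2) * be) * mon (i, j, k)
     - con (q - p^3) * f (i, j, k)"

lemma low_A: "v \<in> low d \<Longrightarrow> A v \<in> low (Suc d)"
  unfolding A_def using low_mon_mult[of v d "(1,0,0)"] by simp

lemma A_mon: "A (mon (i, j, k)) = mon (Suc i, j, k)"
  by (simp add: A_def mon_mult)

text \<open>The degree rises by at most one; the 2 comes from the strict bound in
  \<open>low\<close>.\<close>

definition bounded :: "(idx \<Rightarrow> (idx \<Rightarrow>\<^sub>0 'r)) \<Rightarrow> bool" where
  "bounded f \<longleftrightarrow> (\<forall>m. f m \<in> low (deg m + 2))"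

lemma boundedD: "bounded f \<Longrightarrow> f (i, j, k) \<in> low (i + j + k + 2)"
  unfolding bounded_def by (metis deg.simps)

lemma bounded_lin:
  assumes "bounded f" "v \<in> low d" shows "lin f v \<in> low (Suc d)"
proof (rule low_lin)
  fix m assume "m \<in> Poly_Mapping.keys v"
  then have "deg m < d" using assms(2) by (simp add: low_def)
  then show "f m \<in> low (Suc d)"
    using low_mono[of "f m" "deg m + 2" "Suc d"] assms(1) by (simp add: bounded_def)
qed

lemma bounded_stepB:
  assumes "bounded f" "bounded g" shows "bounded (stepB f g)"
proof -
  have "stepB f g (i, j, k) \<in> low (deg (i, j, k) + 2)" for i j k
  proof (cases i)
    case 0
    then show ?thesis by (simp add: low_mon)
  next
    case (Suc n)
    have "f (n,j,k) \<in> low (n+j+k+2)" "g (n,j,k) \<in> low (n+j+k+2)"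
      using assms by (simp_all only: boundedD)
    then show ?thesis using low_mono[of "g (n,j,k)" "n+j+k+2" "n+j+k+3"] low_A[of "f (n,j,k)" "n+j+k+2"]
      unfolding Suc stepB.simps
      by (intro low_add low_diff low_con) (auto simp: low_mon numeral_3_eq_3)
  qed
  then show ?thesis by (auto simp: bounded_def)
qed

lemma low_tailC: "bounded h \<Longrightarrow> tailC h j k \<in> low (Suc (j + k))"
proof (induction j)
  case (Suc j)
  then show ?case using bounded_lin[OF Suc.prems Suc.IH[OF Suc.prems]]
    by (auto intro!: low_add low_diff low_con simp: low_mon)
qed simp

lemma bounded_stepC:
  assumes "bounded f" "bounded g" shows "bounded (stepC f g)"
proof -
  have "stepC f g (i, j, k) \<in> low (deg (i, j, k) + 2)" for i j k
  proof (cases i)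
    case 0
    then show ?thesis using low_tailC[OF bounded_stepB[OF assms], of j k]
      by (auto intro!: low_add low_con low_mon elim: low_mono)
  next
    case (Suc n)
    have "f (n,j,k) \<in> low (n+j+k+2)" "g (n,j,k) \<in> low (n+j+k+2)"
      using assms by (simp_all only: boundedD)
    then show ?thesis using low_mono[of "f (n,j,k)" "n+j+k+2" "n+j+k+3"] low_A[of "g (n,j,k)" "n+j+k+2"]
      unfolding Suc stepC.simps
      by (intro low_add low_diff low_con) (auto simp: low_mon numeral_3_eq_3)
  qed
  then show ?thesis by (auto simp: bounded_def)
qed

section \<open>Convergence of the approximations\<close>

definition agree :: "nat \<Rightarrow> (idx \<Rightarrow> (idx \<Rightarrow>\<^sub>0 'r)) \<Rightarrow> (idx \<Rightarrow> (idx \<Rightarrow>\<^sub>0 'r)) \<Rightarrow> bool" where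
  "agree d f g \<longleftrightarrow> (\<forall>m. deg m < d \<longrightarrow> f m = g m)"

lemma agree_lin: "agree d f g \<Longrightarrow> v \<in> low d \<Longrightarrow> lin f v = lin g v"
  by (rule lin_cong) (simp add: agree_def low_def)

lemma agree_stepB:
  assumes "agree d f f'" "agree d g g'" shows "agree (Suc d) (stepB f g) (stepB f' g')"
proof -
  have "stepB f g (i, j, k) = stepB f' g' (i, j, k)" if "deg (i, j, k) < Suc d" for i j k
    using that assms by (cases i) (simp_all add: agree_def)
  then show ?thesis by (auto simp: agree_def)
qed

text \<open>\<open>tailC\<close> feeds values of the operator back into it. Boundedness keeps these
  values in the range of degrees where the two operators agree.\<close>

lemma agree_tailC:
  assumes "bounded h" "agree d h h'" "j + k < d"
  shows "tailC h j k = tailC h' j k"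
  using assms(3)
proof (induction j)
  case (Suc j)
  then show ?case
    using agree_lin[OF assms(2), of "tailC h j k"] low_tailC[OF assms(1), of j k] low_mono
    by fastforce
qed simp

lemma agree_stepC:
  assumes "agree d f f'" "agree d g g'" "bounded f" "bounded g"
  shows "agree (Suc d) (stepC f g) (stepC f' g')"
proof -
  have "stepC f g (i, j, k) = stepC f' g' (i, j, k)" if "deg (i, j, k) < Suc d" for i j k
    using that assms agree_tailC[OF bounded_stepB[OF assms(3,4)] agree_stepB[OF assms(1,2)], of j k]
    by (cases i) (simp_all add: agree_def)
  then show ?thesis by (auto simp: agree_def)
qed

primrec approx :: "nat \<Rightarrow> (idx \<Rightarrow> (idx \<Rightarrow>\<^sub>0 'r)) \<times> (idx \<Rightarrow> (idx \<Rightarrow>\<^sub>0 'r))" where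
  "approx 0 = (\<lambda>_. 0, \<lambda>_. 0)"
| "approx (Suc n) = (stepB (fst (approx n)) (snd (approx n)), stepC (fst (approx n)) (snd (approx n)))"

lemma bounded_approx: "bounded (fst (approx n)) \<and> bounded (snd (approx n))"
  by (induction n) (simp_all add: bounded_def[of "\<lambda>_. 0"] bounded_stepB bounded_stepC)

text \<open>Here \<open>e\<close> is fixed: for \<open>n = 0\<close> agreement is vacuous, whatever
  \<open>e\<close> iterations have produced, and each further step on both sides gains one
  degree.\<close>

lemma agree_approx:
  "agree n (fst (approx n)) (fst (approx (n + e))) \<and> agree n (snd (approx n)) (snd (approx (n + e)))"
proof (induction n)
  case 0 show ?case by (simp add: agree_def)
next
  case (Suc n)
  then show ?case using bounded_approx[of n]
    by (simp add: agree_stepB agree_stepC)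
qed

text \<open>From iteration \<open>Suc (deg m)\<close> on, the value at \<open>m\<close> no longer
  changes.\<close>

definition baseB :: "idx \<Rightarrow> (idx \<Rightarrow>\<^sub>0 'r)" where "baseB m = fst (approx (Suc (deg m))) m"
definition baseC :: "idx \<Rightarrow> (idx \<Rightarrow>\<^sub>0 'r)" where "baseC m = snd (approx (Suc (deg m))) m"

lemma agree_base: "agree d (fst (approx d)) baseB" "agree d (snd (approx d)) baseC"
proof -
  have "fst (approx d) m = baseB m \<and> snd (approx d) m = baseC m" if "deg m < d" for m
  proof -
    from that obtain e where "d = Suc (deg m) + e" using less_iff_Suc_add by auto
    then show ?thesis using agree_approx[of "Suc (deg m)" e] by (auto simp: agree_def baseB_def baseC_def)
  qed
  then show "agree d (fst (approx d)) baseB" "agree d (snd (approx d)) baseC"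
    by (auto simp: agree_def)
qed

lemma baseB_fix: "baseB = stepB baseB baseC"
proof
  fix m
  have "fst (approx (Suc (deg m))) m = stepB baseB baseC m"
    using agree_stepB[OF agree_base(1)[of "deg m"] agree_base(2)[of "deg m"]]
    by (simp add: agree_def)
  then show "baseB m = stepB baseB baseC m" by (simp add: baseB_def)
qed

lemma baseC_fix: "baseC = stepC baseB baseC"
proof
  fix m
  have "snd (approx (Suc (deg m))) m = stepC baseB baseC m"
    using agree_stepC[OF agree_base(1)[of "deg m"] agree_base(2)[of "deg m"]] bounded_approx
    by (simp add: agree_def)
  then show "baseC m = stepC baseB baseC m" by (simp add: baseC_def)
qed

lemma bounded_base: "bounded baseB" "bounded baseC"
  using bounded_approx unfolding bounded_def baseB_def baseC_def by blast+

section \<open>The operators and their relations\<close>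

definition B :: "(idx \<Rightarrow>\<^sub>0 'r) \<Rightarrow> (idx \<Rightarrow>\<^sub>0 'r)" where "B = lin baseB"
definition C :: "(idx \<Rightarrow>\<^sub>0 'r) \<Rightarrow> (idx \<Rightarrow>\<^sub>0 'r)" where "C = lin baseC"

lemma A_zero [simp]: "A 0 = 0" by (simp add: A_def)
lemma B_zero [simp]: "B 0 = 0" by (simp add: B_def)
lemma A_add: "A (v + w) = A v + A w" by (simp add: A_def algebra_simps)
lemma B_add: "B (v + w) = B v + B w" by (simp add: B_def lin_add)
lemma C_add: "C (v + w) = C v + C w" by (simp add: C_def lin_add)
lemma A_diff: "A (v - w) = A v - A w" by (simp add: A_def algebra_simps)
lemma B_diff: "B (v - w) = B v - B w" by (simp add: B_def lin_diff)
lemma C_diff: "C (v - w) = C v - C w" by (simp add: C_def lin_diff)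
lemma A_con: "A (con r * v) = con r * A v" by (simp add: A_def algebra_simps)
lemma B_con: "B (con r * v) = con r * B v" by (simp add: B_def lin_con)
lemma C_con: "C (con r * v) = con r * C v" by (simp add: C_def lin_con)

lemmas op_linear = A_add B_add C_add A_diff B_diff C_diff A_con B_con C_con

lemma B_mon_0: "B (mon (0, j, k)) = mon (0, Suc j, k)"
  unfolding B_def lin_mon by (subst baseB_fix) simp

lemma BA: "B (A v) = con (q^2) * A (B v) - con ((q^2 - 1) * ga) * v + con (q^3 - p) * C v"
proof (induction v rule: con_mon_induct)
  case (mon m r)
  obtain i j k where m: "m = (i, j, k)" by (cases m)
  have "baseB (Suc i, j, k) = stepB baseB baseC (Suc i, j, k)"
    using baseB_fix by metis
  then have eq: "B (A (mon m)) = con (q^2) * A (B (mon m)) - con ((q^2 - 1) * ga) * mon m + con (q^3 - p) * C (mon m)"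
    by (simp add: m A_mon) (simp add: B_def C_def)
  show ?case unfolding op_linear eq by (simp add: algebra_simps)
qed (simp add: op_linear algebra_simps)

lemma CA: "C (A v) = con (p^2) * A (C v) + con ((1 - p^2) * be) * v - con (q - p^3) * B v"
proof (induction v rule: con_mon_induct)
  case (mon m r)
  obtain i j k where m: "m = (i, j, k)" by (cases m)
  have "baseC (Suc i, j, k) = stepC baseB baseC (Suc i, j, k)"
    using baseC_fix by metis
  then have eq: "C (A (mon m)) = con (p^2) * A (C (mon m)) + con ((1 - p^2) * be) * mon m - con (q - p^3) * B (mon m)"
    by (simp add: m A_mon) (simp add: B_def C_def)
  show ?case unfolding op_linear eq by (simp add: algebra_simps)
qed (simp add: op_linear algebra_simps)

lemma baseC_0: "baseC (0, j, k) = con (q^(2*j)) * mon (0, j, Suc k) + tailC baseB j k"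
  using baseC_fix baseB_fix stepC.simps(1) by metis

lemma C_mon_00: "C (mon (0, 0, k)) = mon (0, 0, Suc k)"
  by (simp add: C_def baseC_0)

text \<open>The recursion of \<open>tailC\<close> in \<open>j\<close> is this relation, read as a
  formula for C on B^(j+1) C^k.\<close>

lemma CB_mon_0:
  "C (B (mon (0, j, k))) = con (q^2) * B (C (mon (0, j, k))) - con ((q^2 - 1) * al) * mon (0, j, k)
    + con (q^3 - p) * A (mon (0, j, k))"
proof -
  have "B (C (mon (0, j, k))) = con (q^(2*j)) * mon (0, Suc j, Suc k) + B (tailC baseB j k)"
    by (simp add: C_def baseC_0 B_add B_con B_mon_0)
  moreover have "C (B (mon (0, j, k))) = con (q^(2*Suc j)) * mon (0, Suc j, Suc k) + tailC baseB (Suc j) k"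
    unfolding B_mon_0 by (simp add: C_def baseC_0 del: tailC.simps)
  ultimately show ?thesis
    by (simp add: B_def A_mon con_simps power2_eq_square algebra_simps)
qed

lemma con_qp: "con q * con p = (1 :: idx \<Rightarrow>\<^sub>0 'r)"
  by (simp add: qp flip: con_mult)

lemma con_pq: "con p * con q = (1 :: idx \<Rightarrow>\<^sub>0 'r)"
  using con_qp by (simp add: mult.commute)

lemma con_pq_left: "con p * (con q * v) = (v :: idx \<Rightarrow>\<^sub>0 'r)" "con q * (con p * v) = (v :: idx \<Rightarrow>\<^sub>0 'r)"
  by (simp_all add: con_pq con_qp flip: mult.assoc)

lemmas qp_simps = con_qp con_pq con_pq_left

text \<open>The defect of the \<open>CB\<close> relation. It commutes with \<open>A\<close>, which is the resolution of the overlap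
  \<open>CBA\<close>, and it vanishes on the elements \<open>B\<^sup>j C\<^sup>k\<close>.\<close>

definition overlap :: "(idx \<Rightarrow>\<^sub>0 'r) \<Rightarrow> (idx \<Rightarrow>\<^sub>0 'r)" where
  "overlap v = C (B v) - con (q^2) * B (C v) + con ((q^2 - 1) * al) * v - con (q^3 - p) * A v"

lemma overlap_A: "overlap (A v) = A (overlap v)"
proof -
  have "overlap (A v) - A (overlap v) = 0"
    unfolding overlap_def BA CA op_linear
    by (simp add: qp_simps con_simps power2_eq_square power3_eq_cube algebra_simps)
  then show ?thesis by simp
qed

lemma overlap_eq_0: "overlap v = 0"
proof (induction v rule: con_mon_induct)
  case (mon m r)
  have "overlap (mon (i, j, k)) = 0" for i j k
  proof (induction i)
    case 0
    show ?case by (simp add: overlap_def CB_mon_0)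
  next
    case (Suc i)
    then show ?case by (simp add: overlap_A flip: A_mon)
  qed
  then have "overlap (mon m) = 0" by (cases m) simp
  moreover have "overlap (con r * mon m) = con r * overlap (mon m)"
    by (simp add: overlap_def op_linear algebra_simps)
  ultimately show ?case by simp
next
  case (add v w)
  have "overlap (v + w) = overlap v + overlap w" by (simp add: overlap_def op_linear algebra_simps)
  then show ?case using add by simp
qed

lemma CB: "C (B v) = con (q^2) * B (C v) - con ((q^2 - 1) * al) * v + con (q^3 - p) * A v"
  using overlap_eq_0[of v] by (simp add: overlap_def algebra_simps)

section \<open>The Casimir operator\<close>

definition Om :: "(idx \<Rightarrow>\<^sub>0 'r) \<Rightarrow> (idx \<Rightarrow>\<^sub>0 'r)" where
  "Om v = con q * A (B (C v)) + con (q^2) * A (A v) + con (p^2) * B (B v) + con (q^2) * C (C v)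
     - con (q * al) * A v - con (p * be) * B v - con (q * ga) * C v"

text \<open>The three relations bring the operators on both sides into the order A, B, C; the
  difference then cancels by qp = 1. \<open>Om_B\<close> and \<open>Om_C\<close> follow the same
  way.\<close>

lemma Om_A: "Om (A v) = A (Om v)"
proof -
  have "Om (A v) - A (Om v) = 0"
    unfolding Om_def BA CA CB op_linear
    by (simp add: qp_simps con_simps power2_eq_square power3_eq_cube algebra_simps)
  then show ?thesis by simp
qed

lemma Om_B: "Om (B v) = B (Om v)"
proof -
  have "Om (B v) - B (Om v) = 0"
    unfolding Om_def BA CA CB op_linear
    by (simp add: qp_simps con_simps power2_eq_square power3_eq_cube algebra_simps)
  then show ?thesis by simp
qed

lemma Om_C: "Om (C v) = C (Om v)"
proof -
  have "Om (C v) - C (Om v) = 0"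
    unfolding Om_def BA CA CB op_linear
    by (simp add: qp_simps con_simps power2_eq_square power3_eq_cube algebra_simps)
  then show ?thesis by simp
qed

lemma Om_con: "Om (con r * v) = con r * Om v"
  unfolding Om_def op_linear by (simp add: algebra_simps)

lemma Om_add: "Om (v + w) = Om v + Om w"
  unfolding Om_def op_linear by (simp add: algebra_simps)

section \<open>Leading terms\<close>

lemma low_B: "v \<in> low d \<Longrightarrow> B v \<in> low (Suc d)"
  unfolding B_def by (rule bounded_lin[OF bounded_base(1)])

lemma low_C: "v \<in> low d \<Longrightarrow> C v \<in> low (Suc d)"
  unfolding C_def by (rule bounded_lin[OF bounded_base(2)])

lemma low_trans: "u - v \<in> low d \<Longrightarrow> v - w \<in> low d \<Longrightarrow> u - w \<in> low d"
  using low_add[of "u - v" d "v - w"] by simp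

text \<open>Moving B past A^i costs q^(2i), and moving C past A^i and B^j costs p^(2i) q^(2j). The
  correction terms of \<open>BA\<close> and \<open>CA\<close> contain one generator fewer.\<close>

lemma lead_BC:
  "B (mon (i, j, k)) - con (q^(2*i)) * mon (i, Suc j, k) \<in> low (Suc (i + j + k)) \<and>
   C (mon (i, j, k)) - con (p^(2*i) * q^(2*j)) * mon (i, j, Suc k) \<in> low (Suc (i + j + k))"
proof (induction i)
  case 0
  show ?case using low_tailC[OF bounded_base(1), of j k]
    by (simp add: B_mon_0) (simp add: C_def baseC_0)
next
  case (Suc i)
  let ?e = "mon (i, j, k) :: idx \<Rightarrow>\<^sub>0 'r"
  have e: "?e \<in> low (Suc (Suc (i + j + k)))" by (simp add: low_mon)
  have BC: "B ?e \<in> low (Suc (Suc (i + j + k)))" "C ?e \<in> low (Suc (Suc (i + j + k)))"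
    by (auto intro!: low_B low_C simp: low_mon)
  have "B (mon (Suc i, j, k)) - con (q^(2*Suc i)) * mon (Suc i, Suc j, k)
      = con (q^2) * A (B ?e - con (q^(2*i)) * mon (i, Suc j, k))
        - con ((q^2 - 1) * ga) * ?e + con (q^3 - p) * C ?e"
    unfolding A_mon[symmetric] BA op_linear
    by (simp add: con_simps power2_eq_square algebra_simps)
  also have "\<dots> \<in> low (Suc (Suc (i + j + k)))"
    using low_A[OF conjunct1[OF Suc]] e BC by (intro low_add low_diff low_con)
  finally have 1: "B (mon (Suc i, j, k)) - con (q^(2*Suc i)) * mon (Suc i, Suc j, k) \<in> low (Suc (Suc (i + j + k)))" .
  have "C (mon (Suc i, j, k)) - con (p^(2*Suc i) * q^(2*j)) * mon (Suc i, j, Suc k)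
      = con (p^2) * A (C ?e - con (p^(2*i) * q^(2*j)) * mon (i, j, Suc k))
        + con ((1 - p^2) * be) * ?e - con (q - p^3) * B ?e"
    unfolding A_mon[symmetric] CA op_linear
    by (simp add: con_simps power2_eq_square algebra_simps)
  also have "\<dots> \<in> low (Suc (Suc (i + j + k)))"
    using low_A[OF conjunct2[OF Suc]] e BC by (intro low_add low_diff low_con)
  finally show ?case using 1 by simp
qed

section \<open>Leading coefficients of products\<close>

fun pbw_word :: "idx \<Rightarrow> (idx \<Rightarrow>\<^sub>0 'r) \<Rightarrow> (idx \<Rightarrow>\<^sub>0 'r)" where
  "pbw_word (i, j, k) v = (A ^^ i) ((B ^^ j) ((C ^^ k) v))"

lemma lead_C_power:
  "(C ^^ n) (mon (i, j, k)) - con (p^(2*i*n) * q^(2*j*n)) * mon (i, j, k + n) \<in> low (i + j + k + n)"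
proof (induction n)
  case (Suc n)
  have "C ((C ^^ n) (mon (i, j, k)) - con (p^(2*i*n) * q^(2*j*n)) * mon (i, j, k + n)) \<in> low (i + j + k + Suc n)"
    using low_C[OF Suc] by simp
  then have 1: "C ((C ^^ n) (mon (i, j, k))) - con (p^(2*i*n) * q^(2*j*n)) * C (mon (i, j, k + n)) \<in> low (i + j + k + Suc n)"
    by (simp only: op_linear)
  have "con (p^(2*i*n) * q^(2*j*n)) * (C (mon (i, j, k + n)) - con (p^(2*i) * q^(2*j)) * mon (i, j, Suc (k + n)))
      \<in> low (i + j + k + Suc n)"
    by (rule low_con) (use lead_BC[of i j "k + n"] in \<open>simp add: add.assoc\<close>)
  then have "con (p^(2*i*n) * q^(2*j*n)) * C (mon (i, j, k + n)) - con (p^(2*i*Suc n) * q^(2*j*Suc n)) * mon (i, j, k + Suc n)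
      \<in> low (i + j + k + Suc n)"
    by (simp add: right_diff_distrib con_simps power_add mult_ac)
  from low_trans[OF 1 this] show ?case by simp
qed simp

lemma lead_B_power:
  "(B ^^ n) (mon (i, j, k)) - con (q^(2*i*n)) * mon (i, j + n, k) \<in> low (i + j + k + n)"
proof (induction n)
  case (Suc n)
  have "B ((B ^^ n) (mon (i, j, k)) - con (q^(2*i*n)) * mon (i, j + n, k)) \<in> low (i + j + k + Suc n)"
    using low_B[OF Suc] by simp
  then have 1: "B ((B ^^ n) (mon (i, j, k))) - con (q^(2*i*n)) * B (mon (i, j + n, k)) \<in> low (i + j + k + Suc n)"
    by (simp only: op_linear)
  have "con (q^(2*i*n)) * (B (mon (i, j + n, k)) - con (q^(2*i)) * mon (i, Suc (j + n), k))
      \<in> low (i + j + k + Suc n)"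
    by (rule low_con) (use lead_BC[of i "j + n" k] in \<open>simp add: ac_simps\<close>)
  then have "con (q^(2*i*n)) * B (mon (i, j + n, k)) - con (q^(2*i*Suc n)) * mon (i, j + Suc n, k)
      \<in> low (i + j + k + Suc n)"
    by (simp add: right_diff_distrib con_simps power_add mult_ac)
  from low_trans[OF 1 this] show ?case by simp
qed simp

lemma A_power_mon: "(A ^^ n) (mon (i, j, k)) = mon (i + n, j, k)"
  by (induction n) (simp_all add: A_mon)

lemma A_power_linear:
  "(A ^^ n) (v - w) = (A ^^ n) v - (A ^^ n) w" "(A ^^ n) (con r * v) = con r * (A ^^ n) v"
  by (induction n) (simp_all add: op_linear)
lemma B_power_linear:
  "(B ^^ n) (v - w) = (B ^^ n) v - (B ^^ n) w" "(B ^^ n) (con r * v) = con r * (B ^^ n) v"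
  by (induction n) (simp_all add: op_linear)

lemma low_A_power: "v \<in> low d \<Longrightarrow> (A ^^ n) v \<in> low (d + n)"
  by (induction n) (simp_all add: low_A)
lemma low_B_power: "v \<in> low d \<Longrightarrow> (B ^^ n) v \<in> low (d + n)"
  by (induction n) (simp_all add: low_B)

text \<open>The scalar collects C^k moved past A^a and B^b, and B^j moved past A^a. The linear
  extension of this map is right multiplication by A^a B^b C^c.\<close>

lemma lead_pbw_word:
  "lead (\<lambda>m. pbw_word m (mon (a, b, c))) (\<lambda>(i, j, k). p^(2*a*k) * q^(2*b*k) * q^(2*a*j)) (a, b, c)"
proof (rule leadI, unfold prod.case)
  fix i j k
  let ?s = "p^(2*a*k) * q^(2*b*k)" and ?d = "i + j + k + deg (a, b, c)"
  have "(A ^^ i) ((B ^^ j) ((C ^^ k) (mon (a, b, c)) - con ?s * mon (a, b, c + k))) \<in> low ?d"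
    using low_A_power[OF low_B_power[OF lead_C_power[of k a b c], of j], of i] by (simp add: ac_simps)
  then have 1: "pbw_word (i, j, k) (mon (a, b, c)) - con ?s * (A ^^ i) ((B ^^ j) (mon (a, b, c + k))) \<in> low ?d"
    by (simp add: A_power_linear B_power_linear)
  have "con ?s * (A ^^ i) ((B ^^ j) (mon (a, b, c + k)) - con (q^(2*a*j)) * mon (a, b + j, c + k)) \<in> low ?d"
    using low_con[OF low_A_power[OF lead_B_power[of j a b "c + k"]], of ?s i] by (simp add: ac_simps)
  then have "con ?s * (A ^^ i) ((B ^^ j) (mon (a, b, c + k)))
      - con (?s * q^(2*a*j)) * mon ((i, j, k) + (a, b, c)) \<in> low ?d"
    unfolding A_power_linear A_power_mon right_diff_distrib
    by (simp add: con_simps mult_ac add.commute)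
  from low_trans[OF 1 this]
  show "pbw_word (i, j, k) (mon (a, b, c)) - con (?s * q^(2*a*j)) * mon ((i, j, k) + (a, b, c)) \<in> low ?d"
    by simp
qed

lemma low_Om: "v \<in> low d \<Longrightarrow> Om v \<in> low (d + 3)"
proof -
  assume v: "v \<in> low d"
  have "A (B (C v)) \<in> low (d + 3)" using low_A[OF low_B[OF low_C[OF v]]] by (simp add: numeral_3_eq_3)
  moreover have "A (A v) \<in> low (d + 3)" "B (B v) \<in> low (d + 3)" "C (C v) \<in> low (d + 3)"
    using low_A[OF low_A[OF v]] low_B[OF low_B[OF v]] low_C[OF low_C[OF v]] by (auto elim: low_mono)
  moreover have "A v \<in> low (d + 3)" "B v \<in> low (d + 3)" "C v \<in> low (d + 3)"
    using low_A[OF v] low_B[OF v] low_C[OF v] by (auto elim: low_mono)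
  ultimately show ?thesis unfolding Om_def by (intro low_add low_diff low_con)
qed

text \<open>Only qABC reaches degree 3n + 3. The factors of C passing A^n and B^n cancel, and B
  passing A^n gives q^(2n).\<close>

lemma lead_Om: "Om (mon (n, n, n)) - con (q^(2*n+1)) * mon (Suc n, Suc n, Suc n) \<in> low (3 * n + 3)"
proof -
  let ?e = "mon (n, n, n) :: idx \<Rightarrow>\<^sub>0 'r"
  have v: "?e \<in> low (3 * n + 1)" by (simp add: low_mon)
  have "p^(2*n) * q^(2*n) = (1 :: 'r)"
    using qp by (simp add: mult.commute flip: power_mult_distrib)
  then have "C ?e - mon (n, n, Suc n) \<in> low (3 * n + 1)"
    using lead_BC[of n n n] by (simp add: mult.commute[of 3] numeral_3_eq_3 add.assoc)
  then have "A (B (C ?e - mon (n, n, Suc n))) \<in> low (3 * n + 3)"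
    using low_A[OF low_B] by (fastforce simp: numeral_3_eq_3)
  then have 1: "A (B (C ?e)) - A (B (mon (n, n, Suc n))) \<in> low (3 * n + 3)"
    by (simp only: op_linear)
  have "A (B (mon (n, n, Suc n)) - con (q^(2*n)) * mon (n, Suc n, Suc n)) \<in> low (3 * n + 3)"
    by (rule low_mono[OF low_A[OF conjunct1[OF lead_BC]]]) simp
  then have "A (B (mon (n, n, Suc n))) - con (q^(2*n)) * mon (Suc n, Suc n, Suc n) \<in> low (3 * n + 3)"
    by (simp only: op_linear A_mon)
  from low_con[OF low_trans[OF 1 this], of q]
  have 2: "con q * A (B (C ?e)) - con (q^(2*n+1)) * mon (Suc n, Suc n, Suc n) \<in> low (3 * n + 3)"
    by (simp add: con_simps algebra_simps)
  have 3: "A (A ?e) \<in> low (3 * n + 3)" "B (B ?e) \<in> low (3 * n + 3)" "C (C ?e) \<in> low (3 * n + 3)"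
    using low_A[OF low_A[OF v]] low_B[OF low_B[OF v]] low_C[OF low_C[OF v]] by (auto elim: low_mono)
  have 4: "A ?e \<in> low (3 * n + 3)" "B ?e \<in> low (3 * n + 3)" "C ?e \<in> low (3 * n + 3)"
    using low_A[OF v] low_B[OF v] low_C[OF v] by (auto elim: low_mono)
  have "Om ?e - con (q^(2*n+1)) * mon (Suc n, Suc n, Suc n)
    = (con q * A (B (C ?e)) - con (q^(2*n+1)) * mon (Suc n, Suc n, Suc n))
      + con (q^2) * A (A ?e) + con (p^2) * B (B ?e) + con (q^2) * C (C ?e)
      - con (q * al) * A ?e - con (p * be) * B ?e - con (q * ga) * C ?e"
    by (simp add: Om_def)
  also have "\<dots> \<in> low (3 * n + 3)"
    using 2 3 4 by - (assumption | rule low_add low_diff low_con)+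
  finally show ?thesis .
qed

text \<open>The factors q^(2k+1) from \<open>lead_Om\<close>, for k < n, multiply to
  q^(n^2).\<close>

lemma lead_Om_power: "(Om ^^ n) 1 - con (q^(n*n)) * mon (n, n, n) \<in> low (3 * n)"
proof (induction n)
  case 0
  show ?case by (simp flip: zero_prod_def)
next
  case (Suc n)
  have "Om ((Om ^^ n) 1 + con (- (q^(n*n))) * mon (n, n, n)) \<in> low (3 * n + 3)"
    using low_Om[OF Suc] by (simp add: con_simps)
  then have 1: "Om ((Om ^^ n) 1) - con (q^(n*n)) * Om (mon (n, n, n)) \<in> low (3 * n + 3)"
    by (simp only: Om_add Om_con) (simp add: con_simps)
  have "con (q^(n*n)) * (Om (mon (n, n, n)) - con (q^(2*n+1)) * mon (Suc n, Suc n, Suc n)) \<in> low (3 * n + 3)"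
    by (rule low_con[OF lead_Om])
  then have "con (q^(n*n)) * Om (mon (n, n, n)) - con (q^(Suc n * Suc n)) * mon (Suc n, Suc n, Suc n) \<in> low (3 * n + 3)"
    by (simp add: con_simps power_add algebra_simps mult_2 mult_2_right)
  from low_trans[OF 1 this] show ?case by (simp add: ac_simps)
qed

text \<open>The hypotheses equate right and left multiplication of \<open>v\<close> by A and by B.
  Comparing coefficients one degree above the top: B^j and C^k pass A in the product on the right
  only; for B, the right product moves C^k past B and the left one moves B past A^i.\<close>

lemma commuting_top:
  assumes v: "v \<in> low (Suc (deg (i, j, k)))"
    and cA: "lin (\<lambda>m. pbw_word m (A 1)) v = A v" and cB: "lin (\<lambda>m. pbw_word m (B 1)) v = B v"
  shows "q^(2*j) * p^(2*k) * Poly_Mapping.lookup v (i, j, k) = Poly_Mapping.lookup v (i, j, k)"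
    and "q^(2*i) * Poly_Mapping.lookup v (i, j, k) = q^(2*k) * Poly_Mapping.lookup v (i, j, k)"
proof -
  have A1: "A 1 = mon (1, 0, 0)" by (simp add: A_def)
  have B1: "B 1 = mon (0, 1, 0)" using B_mon_0[of 0 0] by (simp flip: zero_prod_def)
  have "Poly_Mapping.lookup (A v) ((1, 0, 0) + (i, j, k)) = Poly_Mapping.lookup v (i, j, k)"
    unfolding A_def by (rule lookup_mon_mult)
  then show "q^(2*j) * p^(2*k) * Poly_Mapping.lookup v (i, j, k) = Poly_Mapping.lookup v (i, j, k)"
    using lookup_lead[OF lead_pbw_word v, of 1 0 0] unfolding cA[unfolded A1] by (simp add: mult_ac)
  have "lead baseB (\<lambda>(i, j, k). q^(2*i)) (0, 1, 0)"
    using lead_BC by (intro leadI) (simp add: B_def)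
  from lookup_lead[OF this v]
  have "Poly_Mapping.lookup (B v) (i, Suc j, k) = q^(2*i) * Poly_Mapping.lookup v (i, j, k)"
    by (simp add: B_def)
  then show "q^(2*i) * Poly_Mapping.lookup v (i, j, k) = q^(2*k) * Poly_Mapping.lookup v (i, j, k)"
    using lookup_lead[OF lead_pbw_word v, of 0 1 0] unfolding cB[unfolded B1] by simp
qed

end

section \<open>The free algebra and its ideal of relations\<close>

text \<open>With concatenation as addition of exponents, finitely supported functions on words form the
  free algebra.\<close>

instantiation list :: (type) monoid_add
begin
definition zero_list :: "'a list" where "zero_list = []"
definition plus_list :: "'a list \<Rightarrow> 'a list \<Rightarrow> 'a list" where "plus_list u w = u @ w"
instance by standard (simp_all add: zero_list_def plus_list_def)
end

type_synonym 'a fa = "gen list \<Rightarrow>\<^sub>0 'a"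

text \<open>Moves the problem from \<open>ncmul\<close> to a ring type with its simplification
  rules. Both sides are additive in each factor, so two single words suffice.\<close>

lemma lookup_fa_mult:
  fixes f g :: "'a::comm_ring_1 fa"
  shows "Poly_Mapping.lookup (f * g) = ncmul (Poly_Mapping.lookup f) (Poly_Mapping.lookup g)"
proof
  fix w
  show "Poly_Mapping.lookup (f * g) w = ncmul (Poly_Mapping.lookup f) (Poly_Mapping.lookup g) w"
  proof (induction f rule: poly_mapping_single_add_induct)
    case (single u r)
    show ?case
    proof (induction g rule: poly_mapping_single_add_induct)
      case (single v s)
      have lhs: "Poly_Mapping.lookup (Poly_Mapping.single u r * Poly_Mapping.single v s) w
          = (if w = u @ v then r * s else 0)"
        by (auto simp: mult_single lookup_single when_def plus_list_def)
      have "ncmul (Poly_Mapping.lookup (Poly_Mapping.single u r)) (Poly_Mapping.lookup (Poly_Mapping.single v s)) w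
          = (\<Sum>i\<le>length w. if i = length u then (if w = u @ v then r * s else 0) else 0)"
        unfolding ncmul_def
      proof (rule sum.cong)
        fix i assume "i \<in> {..length w}"
        \<comment> \<open>The splitting of \<open>w\<close> into \<open>u\<close> and
          \<open>v\<close> can occur at one cut only.\<close>
        then have "take i w = u \<and> drop i w = v \<longleftrightarrow> i = length u \<and> w = u @ v"
          by (auto simp: append_eq_conv_conj min_def)
        then have "(if u = take i w \<and> v = drop i w then r * s else 0)
            = (if i = length u \<and> w = u @ v then r * s else 0)"
          by metis
        then show "Poly_Mapping.lookup (Poly_Mapping.single u r) (take i w)
            * Poly_Mapping.lookup (Poly_Mapping.single v s) (drop i w)
            = (if i = length u then (if w = u @ v then r * s else 0) else 0)"
          unfolding lookup_single when_def by (smt (verit) mult_zero_left mult_zero_right)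
      qed simp
      also have "\<dots> = (if w = u @ v then r * s else 0)" by auto
      finally show ?case using lhs by simp
    qed (simp add: ncmul_def lookup_add algebra_simps sum.distrib)
  qed (simp add: ncmul_def lookup_add algebra_simps sum.distrib)
qed

lemma ncmul_con: "ncmul (Poly_Mapping.lookup (con c)) f = ncsmul c f" for f :: "'a::comm_ring_1 nc"
proof
  fix w
  have "ncmul (Poly_Mapping.lookup (con c)) f w = (\<Sum>i\<le>length w. if i = 0 then c * f w else 0)"
    unfolding ncmul_def
    by (rule sum.cong) (auto simp: con_def lookup_single when_def zero_list_def)
  then show "ncmul (Poly_Mapping.lookup (con c)) f w = ncsmul c f w" by (simp add: ncsmul_def)
qed

lemma lookup_fa_one: "Poly_Mapping.lookup 1 = (ncone :: 'a::comm_ring_1 nc)"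
  by (auto simp: lookup_one ncone_def when_def zero_list_def)

lemma lookup_fa_power:
  fixes f :: "'a::comm_ring_1 fa"
  shows "Poly_Mapping.lookup (f ^ n) = ncpow (Poly_Mapping.lookup f) n"
  by (induction n) (simp_all add: ncpow_def lookup_fa_one lookup_fa_mult)

lemma lookup_fa_gen: "Poly_Mapping.lookup (mon [x]) = (ncgen x :: 'a::comm_ring_1 nc)"
  by (auto simp: mon_def ncgen_def lookup_single when_def)

lemma lookup_fa_add: "Poly_Mapping.lookup (f + g) = ncadd (Poly_Mapping.lookup f) (Poly_Mapping.lookup g)"
  for f g :: "'a::comm_ring_1 fa"
  by (auto simp: ncadd_def lookup_add)

lemma lookup_fa_diff: "Poly_Mapping.lookup (f - g) = ncsub (Poly_Mapping.lookup f) (Poly_Mapping.lookup g)"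
  for f g :: "'a::comm_ring_1 fa"
  by (auto simp: ncsub_def lookup_minus)

lemmas lookup_fa = ncmul_con lookup_fa_mult lookup_fa_one lookup_fa_power lookup_fa_gen
  lookup_fa_add lookup_fa_diff

lemma lookup_in_ncpolys [simp]: "Poly_Mapping.lookup f \<in> ncpolys"
  by (simp add: ncpolys_def)

lemma ncpolys_lookup: "f \<in> ncpolys \<Longrightarrow> \<exists>x. f = Poly_Mapping.lookup x"
  unfolding ncpolys_def by (metis lookup_Abs_poly_mapping mem_Collect_eq)

lemma con_commute: "con c * f = f * (con c :: 'a fa)" for f :: "'a::comm_ring_1 fa"
  by (induction f rule: poly_mapping_single_add_induct)
    (simp_all add: con_def mult_single mult.commute algebra_simps)

definition free_cen :: "'a::field \<Rightarrow> gen \<Rightarrow> gen \<Rightarrow> gen \<Rightarrow> 'a fa" where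
  "free_cen q x y z = mon [x] + con (inverse (q^2 - (inverse q)^2))
     * (con q * (mon [y] * mon [z]) - con (inverse q) * (mon [z] * mon [y]))"

definition falpha :: "'a::field \<Rightarrow> 'a fa" where "falpha q = con (q + inverse q) * free_cen q GA GB GC"
definition fbeta :: "'a::field \<Rightarrow> 'a fa" where "fbeta q = con (q + inverse q) * free_cen q GB GC GA"
definition fgamma :: "'a::field \<Rightarrow> 'a fa" where "fgamma q = con (q + inverse q) * free_cen q GC GA GB"

definition fOm :: "'a::field \<Rightarrow> 'a fa" where
  "fOm q = con q * (mon [GA] * mon [GB] * mon [GC]) + con (q^2) * (mon [GA] * mon [GA])
     + con ((inverse q)^2) * (mon [GB] * mon [GB]) + con (q^2) * (mon [GC] * mon [GC])
     - con q * (mon [GA] * falpha q) - con (inverse q) * (mon [GB] * fbeta q)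
     - con q * (mon [GC] * fgamma q)"

lemma lookup_fcen: "Poly_Mapping.lookup (free_cen q x y z) = aw_cen q (ncgen x) (ncgen y) (ncgen z)"
  by (simp add: free_cen_def aw_cen_def lookup_fa)

lemma lookup_falpha: "Poly_Mapping.lookup (falpha q) = aw_alpha q"
  by (simp add: falpha_def aw_alpha_def lookup_fa lookup_fcen)
lemma lookup_fbeta: "Poly_Mapping.lookup (fbeta q) = aw_beta q"
  by (simp add: fbeta_def aw_beta_def lookup_fa lookup_fcen)
lemma lookup_fgamma: "Poly_Mapping.lookup (fgamma q) = aw_gamma q"
  by (simp add: fgamma_def aw_gamma_def lookup_fa lookup_fcen)
lemma lookup_fOm: "Poly_Mapping.lookup (fOm q) = aw_Omega q"
  by (simp add: fOm_def aw_Omega_def lookup_fa lookup_falpha lookup_fbeta lookup_fgamma)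

lemma lookup_fmon:
  "Poly_Mapping.lookup (fOm q ^ l * falpha q ^ r * fbeta q ^ s * fgamma q ^ t) = aw_mon q (l, r, s, t)"
  by (simp add: aw_mon_def lookup_fa lookup_falpha lookup_fbeta lookup_fgamma lookup_fOm)

definition rel_ideal :: "'a::field \<Rightarrow> 'a fa set" where
  "rel_ideal q = {x. Poly_Mapping.lookup x \<in> aw_ideal q}"

definition free_cens :: "'a::field \<Rightarrow> 'a fa set" where
  "free_cens q = {free_cen q GA GB GC, free_cen q GB GC GA, free_cen q GC GA GB}"

lemma aw_rels_iff:
  "r \<in> aw_rels q \<longleftrightarrow> (\<exists>z\<in>free_cens q. \<exists>g. r = Poly_Mapping.lookup (z * mon [g] - mon [g] * z))"
proof -
  have 1: "{aw_cen q gA gB gC, aw_cen q gB gC gA, aw_cen q gC gA gB} = Poly_Mapping.lookup ` free_cens q"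
    by (simp add: free_cens_def lookup_fcen)
  have 2: "{gA, gB, gC} = range (ncgen :: gen \<Rightarrow> 'a nc)"
    by (auto intro: gen.exhaust) (metis gen.exhaust)
  show ?thesis
    unfolding aw_rels_def 1 2 lookup_fa by blast
qed

lemma rel_ideal_induct [consumes 1, case_names zero gen add]:
  assumes "x \<in> rel_ideal q"
    and "P 0"
    and "\<And>u v z g. z \<in> free_cens q \<Longrightarrow> P (u * (z * mon [g] - mon [g] * z) * v)"
    and "\<And>x y. x \<in> rel_ideal q \<Longrightarrow> y \<in> rel_ideal q \<Longrightarrow> P x \<Longrightarrow> P y \<Longrightarrow> P (x + y)"
  shows "P x"
proof -
  \<comment> \<open>The inductive set consists of bare functions, so the induction carries a
    polynomial representing each of them.\<close>
  have "\<exists>x. f = Poly_Mapping.lookup x \<and> P x" if "f \<in> aw_ideal q" for f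
    using that
  proof induction
    case zero
    show ?case using assms(2) by (auto intro!: exI[of _ 0])
  next
    case (gen r u v)
    then obtain u' v' z g where "u = Poly_Mapping.lookup u'" "v = Poly_Mapping.lookup v'" "z \<in> free_cens q"
      "r = Poly_Mapping.lookup (z * mon [g] - mon [g] * z)"
      using ncpolys_lookup aw_rels_iff by metis
    then show ?case using assms(3) by (metis lookup_fa_mult)
  next
    case (add f g)
    then show ?case using assms(4) by (auto simp: rel_ideal_def lookup_fa_add[symmetric])
  qed
  then show ?thesis using assms(1) unfolding rel_ideal_def by (metis lookup_inject mem_Collect_eq)
qed

lemma rel_ideal_zero [simp]: "0 \<in> rel_ideal q"
  using aw_ideal.zero[of q] by (simp add: rel_ideal_def zero_poly_mapping.rep_eq)

lemma rel_ideal_gen: "z \<in> free_cens q \<Longrightarrow> u * (z * mon [g] - mon [g] * z) * v \<in> rel_ideal q"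
  unfolding rel_ideal_def mem_Collect_eq lookup_fa_mult[of _ v] lookup_fa_mult[of u]
  by (rule aw_ideal.gen) (auto simp: aw_rels_iff)

lemma rel_ideal_add: "x \<in> rel_ideal q \<Longrightarrow> y \<in> rel_ideal q \<Longrightarrow> x + y \<in> rel_ideal q"
  by (simp add: rel_ideal_def lookup_fa_add aw_ideal.add)

text \<open>The generators of the ideal have the form u r v, so a multiplier is absorbed into
  \<open>u\<close> or \<open>v\<close>. Closure under negation is multiplication by -1.\<close>

lemma rel_ideal_mult_left: "x \<in> rel_ideal q \<Longrightarrow> y * x \<in> rel_ideal q"
proof (induction rule: rel_ideal_induct)
  case (gen u v z g)
  then show ?case using rel_ideal_gen[of z q "y * u" g v] by (simp add: mult.assoc)
qed (simp_all add: algebra_simps rel_ideal_add)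

lemma rel_ideal_mult_right: "x \<in> rel_ideal q \<Longrightarrow> x * y \<in> rel_ideal q"
proof (induction rule: rel_ideal_induct)
  case (gen u v z g)
  then show ?case using rel_ideal_gen[of z q u g "v * y"] by (simp add: mult.assoc)
qed (simp_all add: algebra_simps rel_ideal_add)

lemma rel_ideal_uminus: "x \<in> rel_ideal q \<Longrightarrow> - x \<in> rel_ideal q"
  using rel_ideal_mult_left[of x q "-1"] by simp

lemma rel_ideal_diff: "x \<in> rel_ideal q \<Longrightarrow> y \<in> rel_ideal q \<Longrightarrow> x - y \<in> rel_ideal q"
  using rel_ideal_add[of x q "- y"] rel_ideal_uminus by fastforce

section \<open>Congruence modulo the ideal\<close>

definition cong :: "'a::field \<Rightarrow> 'a fa \<Rightarrow> 'a fa \<Rightarrow> bool" where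
  "cong q x y \<longleftrightarrow> x - y \<in> rel_ideal q"

lemma cong_refl [simp]: "cong q x x" by (simp add: cong_def)
lemma cong_sym: "cong q x y \<Longrightarrow> cong q y x" unfolding cong_def using rel_ideal_uminus by fastforce
lemma cong_trans [trans]: "cong q x y \<Longrightarrow> cong q y z \<Longrightarrow> cong q x z"
  unfolding cong_def using rel_ideal_add[of "x - y" q "y - z"] by simp
lemma cong_add: "cong q x y \<Longrightarrow> cong q x' y' \<Longrightarrow> cong q (x + x') (y + y')"
  unfolding cong_def using rel_ideal_add[of "x - y" q "x' - y'"] by (simp add: algebra_simps)
lemma cong_diff: "cong q x y \<Longrightarrow> cong q x' y' \<Longrightarrow> cong q (x - x') (y - y')"
  unfolding cong_def using rel_ideal_diff[of "x - y" q "x' - y'"] by (simp add: algebra_simps)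
lemma cong_mult: "cong q x y \<Longrightarrow> cong q x' y' \<Longrightarrow> cong q (x * x') (y * y')"
proof -
  assume "cong q x y" "cong q x' y'"
  then have "(x - y) * x' + y * (x' - y') \<in> rel_ideal q"
    unfolding cong_def by (intro rel_ideal_add rel_ideal_mult_left rel_ideal_mult_right)
  then show ?thesis by (simp add: cong_def algebra_simps)
qed
lemma cong_left: "cong q x y \<Longrightarrow> cong q (z * x) (z * y)" by (simp add: cong_mult)
lemma cong_right: "cong q x y \<Longrightarrow> cong q (x * z) (y * z)" by (simp add: cong_mult)

section \<open>Representatives of central elements\<close>

definition centre :: "'a::field \<Rightarrow> 'a fa set" where
  "centre q = {z. \<forall>y. cong q (z * y) (y * z)}"

lemma aw_central_lookup: "aw_central q (Poly_Mapping.lookup x) \<longleftrightarrow> x \<in> centre q"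
proof -
  have "(\<forall>y\<in>ncpolys. P y) \<longleftrightarrow> (\<forall>y. P (Poly_Mapping.lookup y))" for P :: "'a nc \<Rightarrow> bool"
    using ncpolys_lookup lookup_in_ncpolys by metis
  then show ?thesis
    by (simp add: aw_central_def centre_def cong_def rel_ideal_def lookup_fa)
qed

lemma centreD: "z \<in> centre q \<Longrightarrow> cong q (z * y) (y * z)" by (simp add: centre_def)

lemma centre_con: "con c \<in> centre q" by (simp add: centre_def con_commute)
lemma centre_one: "1 \<in> centre q" by (simp add: centre_def)

lemma centre_add: "x \<in> centre q \<Longrightarrow> y \<in> centre q \<Longrightarrow> x + y \<in> centre q"
  by (simp add: centre_def cong_add algebra_simps)

lemma centre_diff: "x \<in> centre q \<Longrightarrow> y \<in> centre q \<Longrightarrow> x - y \<in> centre q"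
  by (simp add: centre_def cong_diff algebra_simps)

lemma centre_mult:
  assumes "x \<in> centre q" "y \<in> centre q" shows "x * y \<in> centre q"
proof -
  have "cong q (x * y * z) (z * (x * y))" for z
  proof -
    have "cong q (x * (y * z)) (x * (z * y))" using assms by (intro cong_left centreD)
    also have "x * (z * y) = x * z * y" by (simp add: mult.assoc)
    also have "cong q (x * z * y) (z * x * y)" using assms by (intro cong_right centreD)
    finally show ?thesis by (simp add: mult.assoc)
  qed
  then show ?thesis by (simp add: centre_def)
qed

lemma centre_power: "x \<in> centre q \<Longrightarrow> x ^ n \<in> centre q"
  by (induction n) (simp_all add: centre_one centre_mult)

text \<open>Words grow by a generator on the left, matching the way operators act on a left
  module.\<close>

lemma fa_induct [case_names one gen add con]:
  fixes x :: "'a::comm_ring_1 fa"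
  assumes one: "P 1" and gen: "\<And>g x. P x \<Longrightarrow> P (mon [g] * x)"
    and add: "\<And>x y. P x \<Longrightarrow> P y \<Longrightarrow> P (x + y)" and con: "\<And>c x. P x \<Longrightarrow> P (con c * x)"
  shows "P x"
proof (induction x rule: con_mon_induct)
  case (mon w c)
  have "P (mon w)"
  proof (induction w)
    case Nil
    then show ?case using one by (simp flip: zero_list_def)
  next
    case (Cons g w)
    from gen[OF this, of g] show ?case by (simp add: mon_mult plus_list_def)
  qed
  then show ?case by (rule con)
qed (rule add)

text \<open>The relations give commutation with single generators; a word is passed one letter at a
  time.\<close>

lemma centre_fcens: "z \<in> free_cens q \<Longrightarrow> z \<in> centre q"
proof -
  assume z: "z \<in> free_cens q"
  have "cong q (z * y) (y * z)" for y
  proof (induction y rule: fa_induct)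
    case (gen g y)
    have "cong q (z * mon [g]) (mon [g] * z)"
      using rel_ideal_gen[OF z, of 1 g 1] by (simp add: cong_def)
    from cong_right[OF this, of y]
    have "cong q (z * (mon [g] * y)) (mon [g] * (z * y))" by (simp add: mult.assoc)
    also have "cong q (mon [g] * (z * y)) (mon [g] * (y * z))" by (rule cong_left[OF gen])
    finally show ?case by (simp add: mult.assoc)
  next
    case (con c y)
    from cong_left[OF this, of "con c"] show ?case
      by (metis con_commute mult.assoc)
  qed (simp_all add: algebra_simps cong_add)
  then show ?thesis by (simp add: centre_def)
qed

lemma centre_abc: "falpha q \<in> centre q" "fbeta q \<in> centre q" "fgamma q \<in> centre q"
  unfolding falpha_def fbeta_def fgamma_def
  by (intro centre_mult centre_con centre_fcens; simp add: free_cens_def)+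

section \<open>The representation and its kernel\<close>

definition va :: "idx \<Rightarrow>\<^sub>0 'a::comm_ring_1" where "va = mon (1, 0, 0)"
definition vb :: "idx \<Rightarrow>\<^sub>0 'a::comm_ring_1" where "vb = mon (0, 1, 0)"
definition vc :: "idx \<Rightarrow>\<^sub>0 'a::comm_ring_1" where "vc = mon (0, 0, 1)"

locale askey_wilson =
  fixes q :: "'a::field"
  assumes q_nz: "q \<noteq> 0" and q_root: "\<And>n. n > 0 \<Longrightarrow> q ^ n \<noteq> 1"
begin

lemma q2_nz: "q^2 - (inverse q)^2 \<noteq> 0"
proof
  assume "q^2 - (inverse q)^2 = 0"
  then have "q^2 * q^2 = 1" using q_nz by (simp add: field_simps)
  then have "q^4 = 1" by (simp flip: power_add)
  then show False using q_root[of 4] by simp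
qed

lemma q1_nz: "q + inverse q \<noteq> 0"
proof
  assume "q + inverse q = 0"
  then have "(q + inverse q) * (q - inverse q) = 0" by simp
  then show False using q2_nz by (simp add: algebra_simps power2_eq_square)
qed

lemma q_power_inj: "q ^ i = q ^ j \<Longrightarrow> i = j"
proof (induction i j rule: linorder_wlog)
  case (le i j)
  have "q ^ i * q ^ (j - i) = q ^ j" using le(1) by (simp flip: power_add)
  then have "q ^ i * q ^ (j - i) = q ^ i * 1" using le(2) by simp
  then have "q ^ (j - i) = 1" using q_nz by simp
  then show ?case using q_root[of "j - i"] le by force
qed simp

text \<open>The type \<open>idx\<close> now has two roles: inner exponents are those of \<alpha>,
  \<beta>, \<gamma> in R, outer exponents those of A, B, C.\<close>

sublocale aw_scalars "con q" "con (inverse q)" va vb vc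
  by unfold_locales (simp add: q_nz flip: con_mult)

abbreviation scal :: "'a \<Rightarrow> (idx \<Rightarrow>\<^sub>0 (idx \<Rightarrow>\<^sub>0 'a))" where "scal c \<equiv> con (con c)"

fun gen_op :: "gen \<Rightarrow> (idx \<Rightarrow>\<^sub>0 (idx \<Rightarrow>\<^sub>0 'a)) \<Rightarrow> (idx \<Rightarrow>\<^sub>0 (idx \<Rightarrow>\<^sub>0 'a))" where
  "gen_op GA = A" | "gen_op GB = B" | "gen_op GC = C"

lemma gen_op_add: "gen_op g (v + w) = gen_op g v + gen_op g w" by (cases g) (simp_all add: op_linear)
lemma gen_op_con: "gen_op g (con r * v) = con r * gen_op g v" by (cases g) (simp_all add: op_linear)

definition rho :: "'a fa \<Rightarrow> (idx \<Rightarrow>\<^sub>0 (idx \<Rightarrow>\<^sub>0 'a)) \<Rightarrow> (idx \<Rightarrow>\<^sub>0 (idx \<Rightarrow>\<^sub>0 'a))" where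
  "rho x v = sum_extend (\<lambda>w c. scal c * foldr gen_op w v) x"

lemma rho_add: "rho (x + y) v = rho x v + rho y v"
  unfolding rho_def by (rule sum_extend_add) (simp_all add: con_add algebra_simps)

lemma rho_con_mon: "rho (con c * mon w) v = scal c * foldr gen_op w v"
  by (simp add: rho_def con_mult_mon sum_extend_single)

lemma foldr_gen_op_linear:
  "foldr gen_op w (v + v') = foldr gen_op w v + foldr gen_op w v'" "foldr gen_op w (con r * v) = con r * foldr gen_op w v"
  by (induction w) (simp_all add: gen_op_add gen_op_con)

lemma rho_vadd: "rho x (v + v') = rho x v + rho x v'"
  by (induction x rule: con_mon_induct) (simp_all add: rho_con_mon rho_add foldr_gen_op_linear algebra_simps)

lemma rho_vcon: "rho x (con r * v) = con r * rho x v"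
  by (induction x rule: con_mon_induct)
    (simp_all add: rho_con_mon rho_add foldr_gen_op_linear distrib_left mult.left_commute)

lemma rho_mult: "rho (x * y) v = rho x (rho y v)"
proof (induction x rule: con_mon_induct)
  case (mon u c)
  show ?case
  proof (induction y rule: con_mon_induct)
    case (mon w d)
    have "con c * mon u * (con d * mon w) = (con (c * d) * mon (u + w) :: 'a fa)"
      by (simp add: con_mult_mon mult_single)
    then have "rho (con c * mon u * (con d * mon w)) v = scal (c * d) * foldr gen_op (u + w) v"
      by (simp only: rho_con_mon)
    then show ?case
      by (simp add: rho_con_mon foldr_gen_op_linear plus_list_def con_mult mult.assoc)
  qed (simp add: rho_add rho_vadd algebra_simps)
qed (simp add: rho_add algebra_simps)

lemma rho_con: "rho (con c) v = scal c * v"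
proof -
  have "rho (con c * mon 0) v = scal c * v"
    by (simp only: rho_con_mon) (simp add: zero_list_def)
  then show ?thesis by simp
qed

lemma rho_gen [simp]: "rho (mon [g]) v = gen_op g v"
  using rho_con_mon[of 1 "[g]"] by simp

lemma rho_one [simp]: "rho 1 v = v"
  using rho_con[of 1] by simp

lemma rho_zero [simp]: "rho 0 v = 0"
  by (simp add: rho_def)

lemma rho_diff: "rho (x - y) v = rho x v - rho y v"
  using rho_add[of "x - y" y v] by simp

lemma rho_power: "rho (x ^ n) v = (rho x ^^ n) v"
  by (induction n) (simp_all add: rho_mult)

lemmas rho_simps = rho_add rho_diff rho_con rho_mult rho_power

lemma scal_hom: "scal (c * d) = scal c * scal d" "scal (c + d) = scal c + scal d" "scal (c - d) = scal c - scal d"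
  by (simp_all add: con_simps)

lemma scal_cancel: "scal c * x = scal c * y \<Longrightarrow> c \<noteq> 0 \<Longrightarrow> x = y"
proof -
  assume "scal c * x = scal c * y" "c \<noteq> 0"
  then have "scal (inverse c) * (scal c * x) = scal (inverse c) * (scal c * y)" by simp
  then have "scal (inverse c * c) * x = scal (inverse c * c) * y" by (simp only: scal_hom mult.assoc)
  then show ?thesis using \<open>c \<noteq> 0\<close> by simp
qed

text \<open>Restores the denominator that the module relations avoid. For \<alpha> take x = Av, y =
  BCv, z = CBv and a = \<alpha>v; the computation rests on (q + q^(-1))(q - q^(-1)) = q^2 -
  q^(-2).\<close>

lemma scal_cen:
  assumes "scal q * y - scal (inverse q) * z = (scal q - scal (inverse q)) * a - (scal (q^2) - scal ((inverse q)^2)) * x"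
  shows "scal (q + inverse q) * (x + scal (inverse (q^2 - (inverse q)^2)) * (scal q * y - scal (inverse q) * z)) = a"
proof -
  let ?s = "q^2 - (inverse q)^2"
  have "scal (inverse ?s) * scal ?s = 1" using q2_nz by (simp flip: scal_hom)
  then have 1: "scal (inverse ?s) * (scal (q^2) - scal ((inverse q)^2)) = 1" by (simp add: scal_hom)
  have 2: "scal (q + inverse q) * (scal q - scal (inverse q)) = scal (q^2) - scal ((inverse q)^2)"
    by (simp add: algebra_simps power2_eq_square flip: scal_hom)
  have "scal (q + inverse q) * (x + scal (inverse ?s) * (scal q * y - scal (inverse q) * z))
      = scal (inverse ?s) * (scal (q + inverse q) * (scal q - scal (inverse q))) * a
      + scal (q + inverse q) * x * (1 - scal (inverse ?s) * (scal (q^2) - scal ((inverse q)^2)))"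
    unfolding assms by (simp add: algebra_simps)
  then show ?thesis unfolding 1 2 by simp
qed

lemma rho_abc:
  "rho (falpha q) v = con va * v"
  "rho (fbeta q) v = con vb * v"
  "rho (fgamma q) v = con vc * v"
proof -
  note simps = qp_simps con_simps power2_eq_square power3_eq_cube algebra_simps
  show "rho (falpha q) v = con va * v"
    unfolding falpha_def free_cen_def rho_simps rho_gen gen_op.simps
    by (rule scal_cen) (simp add: CB simps)
  show "rho (fbeta q) v = con vb * v"
    unfolding fbeta_def free_cen_def rho_simps rho_gen gen_op.simps
    by (rule scal_cen) (simp add: CA simps)
  show "rho (fgamma q) v = con vc * v"
    unfolding fgamma_def free_cen_def rho_simps rho_gen gen_op.simps
    by (rule scal_cen) (simp add: BA simps)
qed

lemma rho_fOm: "rho (fOm q) v = Om v"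
  unfolding fOm_def rho_simps rho_gen gen_op.simps rho_abc Om_def op_linear
  by (simp add: con_simps mult.assoc)

lemma rho_fcens:
  assumes "z \<in> free_cens q"
  shows "\<exists>r. \<forall>v. rho z v = con r * v"
proof -
  obtain a where a: "\<forall>v. scal (q + inverse q) * rho z v = con a * v"
    using assms rho_abc unfolding free_cens_def falpha_def fbeta_def fgamma_def rho_mult rho_con by auto
  have "scal (q + inverse q) * rho z v = scal (q + inverse q) * (con (con (inverse (q + inverse q)) * a) * v)" for v
  proof -
    have "scal (q + inverse q) * scal (inverse (q + inverse q)) = 1" using q1_nz by (simp flip: scal_hom)
    then show ?thesis using a by (simp add: con_mult flip: mult.assoc)
  qed
  then show ?thesis using scal_cancel q1_nz by blast
qed

lemma rho_rel_ideal: "x \<in> rel_ideal q \<Longrightarrow> rho x v = 0"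
proof (induction arbitrary: v rule: rel_ideal_induct)
  case (gen u v' z g)
  from rho_fcens[OF gen] obtain r where r: "\<And>v. rho z v = con r * v" by auto
  have "rho (z * mon [g] - mon [g] * z) w = 0" for w
    by (simp add: rho_simps r gen_op_con)
  moreover have "rho u 0 = 0" using rho_vcon[of u 0 0] by simp
  ultimately show ?case by (simp add: rho_mult)
qed (simp_all add: rho_add)

lemma rho_cong: "cong q x y \<Longrightarrow> rho x v = rho y v"
  using rho_rel_ideal[of "x - y" v] by (simp add: cong_def rho_diff)

section \<open>Lifting scalars and normal forms to the free algebra\<close>

fun cen_mon :: "idx \<Rightarrow> 'a fa" where
  "cen_mon (r, s, t) = falpha q ^ r * fbeta q ^ s * fgamma q ^ t"

lemma centre_cen_mon: "cen_mon n \<in> centre q"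
  by (cases n) (simp add: centre_mult centre_power centre_abc)

text \<open>The lifts of \<alpha>, \<beta>, \<gamma> commute only modulo the ideal, so this and
  \<open>lift_scalar_mult\<close> are congruences rather than equations.\<close>

lemma cen_mon_add: "cong q (cen_mon (m + n)) (cen_mon m * cen_mon n)"
proof -
  obtain r s t r' s' t' where mn: "m = (r, s, t)" "n = (r', s', t')" by (cases m; cases n)
  let ?x = "falpha q ^ r" and ?x' = "falpha q ^ r'" and ?y = "fbeta q ^ s" and ?y' = "fbeta q ^ s'"
    and ?z = "fgamma q ^ t" and ?z' = "fgamma q ^ t'"
  have c: "?x' \<in> centre q" "?x' * ?y' \<in> centre q" by (simp_all add: centre_mult centre_power centre_abc)
  have "cen_mon (m + n) = ?x * (?x' * ?y) * (?y' * ?z * ?z')"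
    by (simp add: mn power_add mult.assoc)
  also have "cong q (?x * (?x' * ?y) * (?y' * ?z * ?z')) (?x * (?y * ?x') * (?y' * ?z * ?z'))"
    using c by (intro cong_right cong_left centreD)
  also have "?x * (?y * ?x') * (?y' * ?z * ?z') = ?x * ?y * ((?x' * ?y') * ?z) * ?z'"
    by (simp add: mult.assoc)
  also have "cong q (?x * ?y * ((?x' * ?y') * ?z) * ?z') (?x * ?y * (?z * (?x' * ?y')) * ?z')"
    using c by (intro cong_right cong_left centreD)
  also have "?x * ?y * (?z * (?x' * ?y')) * ?z' = cen_mon m * cen_mon n"
    by (simp add: mn mult.assoc)
  finally show ?thesis .
qed

definition lift_scalar :: "(idx \<Rightarrow>\<^sub>0 'a) \<Rightarrow> 'a fa" where
  "lift_scalar = sum_extend (\<lambda>n c. con c * cen_mon n)"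

lemma lift_scalar_add: "lift_scalar (r + r') = lift_scalar r + lift_scalar r'"
  unfolding lift_scalar_def by (rule sum_extend_add) (simp_all add: con_add algebra_simps)

lemma lift_scalar_con_mon: "lift_scalar (con c * mon n) = con c * cen_mon n"
  by (simp add: lift_scalar_def con_mult_mon sum_extend_single)

lemma lift_scalar_zero [simp]: "lift_scalar 0 = 0" by (simp add: lift_scalar_def)

lemma lift_scalar_con [simp]: "lift_scalar (con c) = con c"
proof -
  have "cen_mon 0 = 1" by (simp add: zero_prod_def)
  then show ?thesis using lift_scalar_con_mon[of c 0] by simp
qed

lemma lift_scalar_one [simp]: "lift_scalar 1 = 1"
  using lift_scalar_con[of 1] by simp

lemma lift_scalar_vars [simp]: "lift_scalar va = falpha q" "lift_scalar vb = fbeta q" "lift_scalar vc = fgamma q"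
  using lift_scalar_con_mon[of 1 "(1, 0, 0)"] lift_scalar_con_mon[of 1 "(0, 1, 0)"] lift_scalar_con_mon[of 1 "(0, 0, 1)"]
  by (simp_all add: va_def vb_def vc_def)

lemma centre_lift_scalar: "lift_scalar r \<in> centre q"
  by (induction r rule: con_mon_induct)
    (simp_all add: lift_scalar_con_mon lift_scalar_add centre_add centre_mult centre_con centre_cen_mon)

lemma lift_scalar_mult: "cong q (lift_scalar (r * r')) (lift_scalar r * lift_scalar r')"
proof (induction r rule: con_mon_induct)
  case (mon m c)
  show ?case
  proof (induction r' rule: con_mon_induct)
    case (mon n d)
    have "con c * mon m * (con d * mon n) = (con (c * d) * mon (m + n) :: idx \<Rightarrow>\<^sub>0 'a)"
      by (simp add: con_mult_mon mult_single)
    then have "lift_scalar (con c * mon m * (con d * mon n)) = con (c * d) * cen_mon (m + n)"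
      by (simp add: lift_scalar_con_mon)
    also have "cong q (con (c * d) * cen_mon (m + n)) (con (c * d) * (cen_mon m * cen_mon n))"
      by (intro cong_left cen_mon_add)
    also have "con (c * d) * (cen_mon m * cen_mon n) = con c * (con d * cen_mon m) * cen_mon n"
      by (simp add: con_mult mult.assoc)
    also have "\<dots> = lift_scalar (con c * mon m) * lift_scalar (con d * mon n)"
      unfolding con_commute[of d "cen_mon m"] by (simp add: lift_scalar_con_mon mult.assoc)
    finally show ?case .
  qed (simp add: lift_scalar_add algebra_simps cong_add)
qed (simp add: lift_scalar_add algebra_simps cong_add)

fun gen_mon :: "idx \<Rightarrow> 'a fa" where
  "gen_mon (i, j, k) = mon [GA] ^ i * (mon [GB] ^ j * mon [GC] ^ k)"

definition lift :: "(idx \<Rightarrow>\<^sub>0 (idx \<Rightarrow>\<^sub>0 'a)) \<Rightarrow> 'a fa" where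
  "lift = sum_extend (\<lambda>m r. gen_mon m * lift_scalar r)"

lemma lift_add: "lift (v + w) = lift v + lift w"
  unfolding lift_def by (rule sum_extend_add) (simp_all add: lift_scalar_add algebra_simps)

lemma lift_zero [simp]: "lift 0 = 0" by (simp add: lift_def)

lemma lift_diff: "lift (v - w) = lift v - lift w"
  using lift_add[of "v - w" w] by simp

lemma lift_con_mon: "lift (con r * mon m) = gen_mon m * lift_scalar r"
  by (simp add: lift_def con_mult_mon sum_extend_single)

lemma lift_mon [simp]: "lift (mon m) = gen_mon m"
  using lift_con_mon[of 1 m] by simp

lemma lift_con: "cong q (lift (con r * v)) (lift v * lift_scalar r)"
proof (induction v rule: con_mon_induct)
  case (mon m s)
  have "lift (con r * (con s * mon m)) = gen_mon m * lift_scalar (s * r)"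
    using lift_con_mon[of "s * r" m] by (simp add: con_mult mult_ac)
  also have "cong q (gen_mon m * lift_scalar (s * r)) (gen_mon m * (lift_scalar s * lift_scalar r))"
    by (intro cong_left lift_scalar_mult)
  finally show ?case by (simp add: lift_con_mon mult.assoc)
qed (simp add: lift_add algebra_simps cong_add)

lemma lift_con_left: "cong q (lift (con r * v)) (lift_scalar r * lift v)"
  using lift_con cong_trans cong_sym centreD[OF centre_lift_scalar] by meson

lemma lift_A: "lift (A v) = mon [GA] * lift v"
proof (induction v rule: con_mon_induct)
  case (mon m r)
  obtain i j k where m: "m = (i, j, k)" by (cases m)
  have "A (con r * mon m) = con r * mon (Suc i, j, k)" by (simp add: m A_con A_mon)
  then have "lift (A (con r * mon m)) = gen_mon (Suc i, j, k) * lift_scalar r" by (simp only: lift_con_mon)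
  then show ?case by (simp add: lift_con_mon m mult.assoc)
qed (simp add: A_add lift_add algebra_simps)

text \<open>An equation in the free algebra itself, since it only unfolds how \<alpha>, \<beta>,
  \<gamma> are defined. The factor q^2 - 1 clears the denominator: (q^2 - 1)(q + q^(-1)) = q(q^2 -
  q^(-2)) = q^3 - q^(-1).\<close>

lemma fa_rel:
  "con (q^2 - 1) * (con (q + inverse q) * free_cen q x y z)
    = con (q^3 - inverse q) * mon [x] + con (q^2) * (mon [y] * mon [z]) - mon [z] * mon [y]"
proof -
  let ?p = "inverse q" and ?s = "q^2 - (inverse q)^2"
  define u where "u = (q^2 - 1) * (q + ?p)"
  have u: "u = q^3 - ?p" "u = q * ?s"
    using q_nz by (simp_all add: u_def field_simps power2_eq_square power3_eq_cube)
  have "con (q^2 - 1) * (con (q + ?p) * free_cen q x y z) = con u * free_cen q x y z"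
    by (simp add: u_def con_mult mult.assoc)
  also have "\<dots> = con u * mon [x] + con (u * inverse ?s) * (con q * (mon [y] * mon [z]) - con ?p * (mon [z] * mon [y]))"
    by (simp add: free_cen_def con_mult distrib_left mult.assoc)
  also have "u * inverse ?s = q" unfolding u(2) using q2_nz by simp
  also have "con q * (con q * (mon [y] * mon [z]) - con ?p * (mon [z] * mon [y]))
      = con (q^2) * (mon [y] * mon [z]) - con (q * ?p) * (mon [z] * mon [y])"
    by (simp add: right_diff_distrib con_mult power2_eq_square mult.assoc)
  finally show ?thesis unfolding u(1) using q_nz by simp
qed

lemma fa_BA: "mon [GB] * mon [GA] = con (q^2) * (mon [GA] * mon [GB]) - con (q^2 - 1) * fgamma q
    + con (q^3 - inverse q) * mon [GC]"
  using fa_rel[of GC GA GB] by (simp add: fgamma_def)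

lemma fa_CB: "mon [GC] * mon [GB] = con (q^2) * (mon [GB] * mon [GC]) - con (q^2 - 1) * falpha q
    + con (q^3 - inverse q) * mon [GA]"
  using fa_rel[of GA GB GC] by (simp add: falpha_def)

text \<open>Here \<open>fa_rel\<close> is solved for the product with coefficient q^2, hence the
  multiplication by q^(-2).\<close>

lemma fa_CA: "mon [GC] * mon [GA] = con ((inverse q)^2) * (mon [GA] * mon [GC])
    + con (1 - (inverse q)^2) * fbeta q - con (q - (inverse q)^3) * mon [GB]"
proof -
  let ?p = "inverse q"
  have "?p^2 * q^2 = 1" and "?p^2 * (q^2 - 1) = 1 - ?p^2" and "?p^2 * (q^3 - ?p) = q - ?p^3"
    using q_nz by (simp_all add: field_simps power2_eq_square power3_eq_cube)
  moreover have "con (?p^2) * (con (q^2 - 1) * fbeta q)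
      = con (?p^2) * (con (q^3 - ?p) * mon [GB] + con (q^2) * (mon [GC] * mon [GA]) - mon [GA] * mon [GC])"
    using fa_rel[of GB GC GA] by (simp add: fbeta_def)
  ultimately show ?thesis
    by (simp add: distrib_left right_diff_distrib flip: mult.assoc con_mult)
qed

lemma lift_combination:
  "cong q (lift (con r * u - con s * v + con t * w)) (lift_scalar r * lift u - lift_scalar s * lift v + lift_scalar t * lift w)"
  unfolding lift_add lift_diff by (intro cong_add cong_diff lift_con_left)

section \<open>Compatibility of the lift with the generators\<close>

definition lift_commutes_B :: "(idx \<Rightarrow>\<^sub>0 (idx \<Rightarrow>\<^sub>0 'a)) \<Rightarrow> bool" where
  "lift_commutes_B v \<longleftrightarrow> cong q (lift (B v)) (mon [GB] * lift v)"
definition lift_commutes_C :: "(idx \<Rightarrow>\<^sub>0 (idx \<Rightarrow>\<^sub>0 'a)) \<Rightarrow> bool" where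
  "lift_commutes_C v \<longleftrightarrow> cong q (lift (C v)) (mon [GC] * lift v)"

lemma lift_scalar_coeffs:
  "lift_scalar ((con q)^2) = con (q^2)" "lift_scalar ((con (inverse q))^2) = con ((inverse q)^2)"
  "lift_scalar ((con q)^3 - con (inverse q)) = con (q^3 - inverse q)"
  "lift_scalar (con q - (con (inverse q))^3) = con (q - (inverse q)^3)"
  by (simp_all only: con_power[symmetric] con_diff[symmetric] lift_scalar_con)

lemma lift_scalar_coeffs_mult:
  "cong q (lift_scalar (((con q)^2 - 1) * r)) (con (q^2 - 1) * lift_scalar r)"
  "cong q (lift_scalar ((1 - (con (inverse q))^2) * r)) (con (1 - (inverse q)^2) * lift_scalar r)"
proof -
  have "(con q)^2 - 1 = (con (q^2 - 1) :: idx \<Rightarrow>\<^sub>0 'a)" "1 - (con (inverse q))^2 = (con (1 - (inverse q)^2) :: idx \<Rightarrow>\<^sub>0 'a)"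
    by (simp_all add: con_diff con_power)
  then show "cong q (lift_scalar (((con q)^2 - 1) * r)) (con (q^2 - 1) * lift_scalar r)"
    "cong q (lift_scalar ((1 - (con (inverse q))^2) * r)) (con (1 - (inverse q)^2) * lift_scalar r)"
    using lift_scalar_mult[of "con (q^2 - 1)" r] lift_scalar_mult[of "con (1 - (inverse q)^2)" r] by simp_all
qed

text \<open>\<open>BA\<close> in the module and \<open>fa_BA\<close> in the free algebra have the
  same shape, so they match term by term under \<open>lift\<close>.\<close>

lemma lift_commutes_B_A:
  assumes "lift_commutes_B v" "lift_commutes_C v" shows "lift_commutes_B (A v)"
proof -
  have "cong q (lift (B (A v))) (lift_scalar ((con q)^2) * lift (A (B v)) - lift_scalar (((con q)^2 - 1) * vc) * lift v
      + lift_scalar ((con q)^3 - con (inverse q)) * lift (C v))"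
    unfolding BA by (rule lift_combination)
  also have "cong q \<dots> (con (q^2) * (mon [GA] * (mon [GB] * lift v)) - con (q^2 - 1) * fgamma q * lift v
      + con (q^3 - inverse q) * (mon [GC] * lift v))"
    unfolding lift_scalar_coeffs lift_A
    using assms lift_scalar_coeffs_mult(1)[of vc] by (intro cong_add cong_diff cong_left cong_right) (simp_all add: lift_commutes_B_def lift_commutes_C_def)
  also have "\<dots> = mon [GB] * lift (A v)"
    unfolding lift_A mult.assoc[symmetric] fa_BA by (simp add: algebra_simps)
  finally show ?thesis by (simp add: lift_commutes_B_def)
qed

lemma lift_commutes_C_A:
  assumes "lift_commutes_B v" "lift_commutes_C v" shows "lift_commutes_C (A v)"
proof -
  have "cong q (lift (C (A v))) (lift_scalar ((con (inverse q))^2) * lift (A (C v)) + lift_scalar ((1 - (con (inverse q))^2) * vb) * lift v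
      - lift_scalar (con q - (con (inverse q))^3) * lift (B v))"
    unfolding CA lift_add lift_diff by (intro cong_add cong_diff lift_con_left)
  also have "cong q \<dots> (con ((inverse q)^2) * (mon [GA] * (mon [GC] * lift v)) + con (1 - (inverse q)^2) * fbeta q * lift v
      - con (q - (inverse q)^3) * (mon [GB] * lift v))"
    unfolding lift_scalar_coeffs lift_A
    using assms lift_scalar_coeffs_mult(2)[of vb] by (intro cong_add cong_diff cong_left cong_right) (simp_all add: lift_commutes_B_def lift_commutes_C_def)
  also have "\<dots> = mon [GC] * lift (A v)"
    unfolding lift_A mult.assoc[symmetric] fa_CA by (simp add: algebra_simps)
  finally show ?thesis by (simp add: lift_commutes_C_def)
qed

lemma lift_commutes_C_B:
  assumes "lift_commutes_B (C v)" "lift_commutes_C v" "lift_commutes_B v" shows "lift_commutes_C (B v)"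
proof -
  have "cong q (lift (C (B v))) (lift_scalar ((con q)^2) * lift (B (C v)) - lift_scalar (((con q)^2 - 1) * va) * lift v
      + lift_scalar ((con q)^3 - con (inverse q)) * lift (A v))"
    unfolding CB by (rule lift_combination)
  also have "cong q \<dots> (con (q^2) * (mon [GB] * (mon [GC] * lift v)) - con (q^2 - 1) * falpha q * lift v
      + con (q^3 - inverse q) * (mon [GA] * lift v))"
  proof -
    have "cong q (lift (B (C v))) (mon [GB] * (mon [GC] * lift v))"
      using assms cong_trans cong_left unfolding lift_commutes_B_def lift_commutes_C_def by blast
    then show ?thesis unfolding lift_scalar_coeffs lift_A
      using lift_scalar_coeffs_mult(1)[of va] by (intro cong_add cong_diff cong_left cong_right) simp_all
  qed
  also have "\<dots> = mon [GC] * (mon [GB] * lift v)"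
    unfolding mult.assoc[symmetric] fa_CB by (simp add: algebra_simps)
  also have "cong q \<dots> (mon [GC] * lift (B v))"
    using assms(3) unfolding lift_commutes_B_def by (intro cong_left) (rule cong_sym)
  finally show ?thesis by (simp add: lift_commutes_C_def)
qed

text \<open>The bound \<open>d\<close> makes this extension by linearity available inside an
  induction on the degree, where basis elements are settled only below \<open>d\<close>.\<close>

lemma lift_commutes_B_low:
  assumes "\<And>m. deg m < d \<Longrightarrow> lift_commutes_B (mon m)" "v \<in> low d"
  shows "lift_commutes_B v"
proof -
  have con: "lift_commutes_B (con r * v)" if "lift_commutes_B v" for r v
  proof -
    have "cong q (lift (B (con r * v))) (lift (B v) * lift_scalar r)" unfolding B_con by (rule lift_con)
    also have "cong q \<dots> (mon [GB] * lift v * lift_scalar r)" using that by (intro cong_right) (simp add: lift_commutes_B_def)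
    also have "\<dots> = mon [GB] * (lift v * lift_scalar r)" by (simp add: mult.assoc)
    also have "cong q \<dots> (mon [GB] * lift (con r * v))" by (intro cong_left cong_sym[OF lift_con])
    finally show ?thesis by (simp add: lift_commutes_B_def)
  qed
  have sum: "lift_commutes_B (\<Sum>m\<in>M. con (Poly_Mapping.lookup v m) * mon m)" if "M \<subseteq> Poly_Mapping.keys v" "finite M" for M
    using that(2,1)
  proof induction
    case empty
    show ?case by (simp add: lift_commutes_B_def)
  next
    case (insert m M)
    then have "lift_commutes_B (con (Poly_Mapping.lookup v m) * mon m)"
      using assms by (intro con) (auto simp: low_def)
    then show ?case using insert by (simp add: lift_commutes_B_def B_add lift_add cong_add distrib_left)
  qed
  have "lin mon v = v"
    by (induction v rule: con_mon_induct) (simp_all add: lin_add lin_con_mon)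
  then show ?thesis using sum[of "Poly_Mapping.keys v"] by (simp add: lin_expand)
qed

text \<open>Within one degree, \<open>B\<close> comes before \<open>C\<close>: \<open>C B v\<close> reduces to \<open>B C v\<close>, where \<open>C v\<close> has the degree of \<open>B v\<close>.\<close>

lemma lift_commutes_mon: "deg m < d \<Longrightarrow> lift_commutes_B (mon m) \<and> lift_commutes_C (mon m)"
proof (induction d arbitrary: m)
  case (Suc d)
  have B0: "lift_commutes_B (mon (0, j, k))" for j k
    by (simp add: lift_commutes_B_def B_mon_0 mult.assoc)
  have B: "lift_commutes_B (mon m)" if "deg m < Suc d" for m
  proof -
    obtain i j k where m: "m = (i, j, k)" by (cases m)
    show ?thesis
    proof (cases i)
      case (Suc n)
      then show ?thesis using lift_commutes_B_A[of "mon (n, j, k)"] Suc.IH[of "(n, j, k)"] that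
        by (simp add: m A_mon)
    qed (simp add: m B0)
  qed
  have C0: "lift_commutes_C (mon (0, j, k))" if "j + k < Suc d" for j k
    using that
  proof (induction j)
    case 0
    show ?case by (simp add: lift_commutes_C_def C_mon_00)
  next
    case (Suc j)
    have "C (mon (0, j, k)) \<in> low (Suc d)"
      using Suc.prems by (intro low_mono[OF low_C[OF low_mon[of _ "Suc (j + k)"]]]) auto
    then have "lift_commutes_B (C (mon (0, j, k)))" using lift_commutes_B_low B by blast
    then show ?case using lift_commutes_C_B[of "mon (0, j, k)"] Suc B0[of j k] by (simp add: B_mon_0)
  qed
  obtain i j k where m: "m = (i, j, k)" by (cases m)
  have "lift_commutes_C (mon m)"
  proof (cases i)
    case 0
    then show ?thesis using C0 Suc.prems m by simp
  next
    case (Suc n)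
    then show ?thesis using lift_commutes_C_A[of "mon (n, j, k)"] Suc.IH[of "(n, j, k)"] Suc.prems
      by (simp add: m A_mon)
  qed
  then show ?case using B Suc.prems by simp
qed simp

lemma lift_B: "cong q (lift (B v)) (mon [GB] * lift v)"
  using low_exists[of v] lift_commutes_B_low lift_commutes_mon lift_commutes_B_def by metis

lemma lift_C: "cong q (lift (C v)) (mon [GC] * lift v)"
proof (induction v rule: con_mon_induct)
  case (mon m r)
  have "lift_commutes_C (mon m)" using lift_commutes_mon by blast
  then have "cong q (lift (C (mon m)) * lift_scalar r) (mon [GC] * lift (mon m) * lift_scalar r)"
    unfolding lift_commutes_C_def by (rule cong_right)
  moreover have "cong q (lift (C (con r * mon m))) (lift (C (mon m)) * lift_scalar r)"
    unfolding C_con by (rule lift_con)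
  ultimately show ?case unfolding lift_con_mon lift_mon mult.assoc[symmetric] using cong_trans by blast
qed (simp add: C_add lift_add distrib_left cong_add)

lemma lift_rho_one: "cong q (lift (rho x 1)) x"
proof (induction x rule: fa_induct)
  case one
  have "lift (mon 0) = 1" unfolding lift_mon by (simp add: zero_prod_def)
  then show ?case by simp
next
  case (gen g x)
  have "cong q (lift (gen_op g (rho x 1))) (mon [g] * lift (rho x 1))"
    using lift_B lift_C by (cases g) (simp_all add: lift_A)
  also have "cong q \<dots> (mon [g] * x)" by (rule cong_left[OF gen])
  finally show ?case by (simp add: rho_mult)
next
  case (con c x)
  have "cong q (lift (scal c * rho x 1)) (lift_scalar (con c) * lift (rho x 1))" by (rule lift_con_left)
  also have "cong q \<dots> (con c * x)" using con by (simp add: cong_left)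
  finally show ?case by (simp add: rho_mult rho_con)
qed (simp add: rho_add lift_add cong_add)

text \<open>Ideal membership becomes the vanishing of one vector: if it is 0, then \<open>x\<close>
  is congruent to the lift of 0.\<close>

lemma rel_ideal_iff: "x \<in> rel_ideal q \<longleftrightarrow> rho x 1 = 0"
proof
  assume "rho x 1 = 0"
  then have "cong q 0 x" using lift_rho_one[of x] by simp
  then show "x \<in> rel_ideal q" using cong_sym by (fastforce simp: cong_def)
qed (rule rho_rel_ideal)

lemma rho_lift_scalar: "rho (lift_scalar r) v = con r * v"
proof (induction r rule: con_mon_induct)
  case (mon n c)
  obtain i j k where n: "n = (i, j, k)" by (cases n)
  have pow: "((\<lambda>v. x * v) ^^ l) v = x ^ l * v" for x v :: "idx \<Rightarrow>\<^sub>0 (idx \<Rightarrow>\<^sub>0 'a)" and l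
    by (induction l) (simp_all add: mult.assoc)
  have zero: "(0, 0, 0) = (0 :: idx)" by (simp add: zero_prod_def)
  have var: "va ^ l = (mon (l, 0, 0) :: idx \<Rightarrow>\<^sub>0 'a)" "vb ^ l = (mon (0, l, 0) :: idx \<Rightarrow>\<^sub>0 'a)"
     "vc ^ l = (mon (0, 0, l) :: idx \<Rightarrow>\<^sub>0 'a)" for l
    by (induction l) (simp_all add: va_def vb_def vc_def mon_mult zero)
  have "rho (falpha q) = (\<lambda>v. con va * v)" "rho (fbeta q) = (\<lambda>v. con vb * v)" "rho (fgamma q) = (\<lambda>v. con vc * v)"
    by (auto simp: rho_abc)
  then have "rho (cen_mon n) v = con (va ^ i * vb ^ j * vc ^ k) * v"
    by (simp add: n rho_simps pow con_simps mult.assoc)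
  also have "va ^ i * vb ^ j * vc ^ k = (mon n :: idx \<Rightarrow>\<^sub>0 'a)"
    by (simp add: var n mon_mult)
  finally show ?case by (simp add: lift_scalar_con_mon rho_simps con_mult mult.assoc)
qed (simp add: lift_scalar_add rho_add con_add algebra_simps)

lemma rho_lift: "rho (lift v) u = lin (\<lambda>m. pbw_word m u) v"
proof (induction v rule: con_mon_induct)
  case (mon m r)
  obtain i j k where m: "m = (i, j, k)" by (cases m)
  have "rho (mon [GA]) = A" "rho (mon [GB]) = B" "rho (mon [GC]) = C" by auto
  then have pbw_word: "rho (gen_mon m) u = pbw_word m u" for u by (simp add: m rho_simps)
  have "rho (lift (con r * mon m)) u = rho (gen_mon m) (con r * u)"
    by (simp only: lift_con_mon rho_mult rho_lift_scalar)
  also have "\<dots> = con r * pbw_word m u" by (simp only: rho_vcon pbw_word)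
  finally show ?case by (simp only: lin_con_mon)
qed (simp add: lift_add rho_add lin_add)

text \<open>The coordinates \<open>rho x 1\<close> determine the whole action. With a generator
  applied to \<open>1\<close> as \<open>u\<close>, this expresses right multiplication in the form
  that \<open>commuting_top\<close> uses.\<close>

lemma rho_eq: "rho x u = lin (\<lambda>m. pbw_word m u) (rho x 1)"
  using rho_cong[OF lift_rho_one, of x u] rho_lift by simp

section \<open>The centre\<close>

lemma Om_rho: "Om (rho y v) = rho y (Om v)"
proof (induction y rule: fa_induct)
  case (gen g y)
  then show ?case using Om_A Om_B Om_C by (cases g) (simp_all add: rho_mult)
qed (simp_all add: rho_add Om_add rho_mult rho_con Om_con)

text \<open>By \<open>rel_ideal_iff\<close> centrality is tested on the vector \<open>1\<close>,
  where \<Omega> acts as \<open>Om\<close>, so no commutator is expanded in the free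
  algebra.\<close>

lemma centre_fOm: "fOm q \<in> centre q"
proof -
  have "fOm q * y - y * fOm q \<in> rel_ideal q" for y
    unfolding rel_ideal_iff by (simp add: rho_simps rho_fOm Om_rho)
  then show ?thesis by (simp add: centre_def cong_def)
qed

text \<open>The index is that of \<^const>\<open>aw_mon\<close>, since tuples are nested to the right.\<close>

fun fmon :: "nat \<times> idx \<Rightarrow> 'a fa" where
  "fmon (l, n) = fOm q ^ l * cen_mon n"

lemma lookup_fmon_idx: "Poly_Mapping.lookup (fmon k) = aw_mon q k"
  by (cases k) (simp add: lookup_fmon flip: mult.assoc)

lemma centre_fmon: "fmon k \<in> centre q"
  by (cases k) (simp add: centre_mult centre_power centre_fOm centre_abc)

lemma lookup_lincomb:
  "Poly_Mapping.lookup (\<Sum>k\<in>K. con (c k) * fmon k) = aw_lincomb q c K"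
  unfolding aw_lincomb_def
proof
  fix w
  have "Poly_Mapping.lookup (con (c k) * fmon k) w = c k * aw_mon q k w" for k
    by (simp add: lookup_fa lookup_fmon_idx ncsmul_def)
  then show "Poly_Mapping.lookup (\<Sum>k\<in>K. con (c k) * fmon k) w = (\<Sum>k\<in>K. c k * aw_mon q k w)"
    by (simp add: lookup_sum)
qed

section \<open>Linear independence\<close>

lemma rho_fOm_power: "rho (fOm q ^ n) v = (Om ^^ n) v"
proof -
  have "rho (fOm q) = Om" by (auto simp: rho_fOm)
  then show ?thesis by (simp add: rho_power)
qed

lemma Om_power_con: "(Om ^^ n) (con r * v) = con r * (Om ^^ n) v"
  by (induction n) (simp_all add: Om_con)

lemma rho_fmon: "rho (con c * fmon (l, n)) 1 = con (Poly_Mapping.single n c) * (Om ^^ l) 1"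
proof -
  have "rho (con c * fmon (l, n)) 1 = rho (fOm q ^ l) (rho (lift_scalar (con c * mon n)) 1)"
    by (simp add: lift_scalar_con_mon rho_mult rho_con rho_vcon)
  also have "\<dots> = con (Poly_Mapping.single n c) * (Om ^^ l) 1"
    unfolding rho_lift_scalar rho_fOm_power Om_power_con con_mult_mon ..
  finally show ?thesis .
qed

lemma lookup_Om_power:
  assumes "3 * n \<le> deg m"
  shows "Poly_Mapping.lookup ((Om ^^ n) 1) m = (if m = (n, n, n) then con (q^(n*n)) else 0)"
proof -
  have "Poly_Mapping.lookup ((Om ^^ n) 1 - con ((con q)^(n*n)) * mon (n, n, n)) m = 0"
    by (rule low_lookup[OF lead_Om_power assms])
  then show ?thesis
    unfolding lookup_minus lookup_con_mult by (auto simp: con_power mon_def lookup_single when_def)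
qed

text \<open>Let L be the highest power of \<Omega> with a nonzero coefficient. Lower powers miss A^L
  B^L C^L, so its coefficient is q^(L^2) times a polynomial in \<alpha>, \<beta>, \<gamma>, from
  which one entry is read off.\<close>

lemma fmon_independent:
  assumes K: "finite K" and rel_ideal: "(\<Sum>k\<in>K. con (c k) * fmon k) \<in> rel_ideal q" and "k \<in> K"
  shows "c k = 0"
proof (rule ccontr)
  assume "c k \<noteq> 0"
  let ?N = "{k \<in> K. c k \<noteq> 0}"
  have N: "finite ?N" "?N \<noteq> {}" using K \<open>k \<in> K\<close> \<open>c k \<noteq> 0\<close> by (simp, blast)
  define L where "L = Max (fst ` ?N)"
  have L: "l \<le> L" if "(l, n) \<in> K" "c (l, n) \<noteq> 0" for l n
    unfolding L_def using that N by (intro Max_ge) force+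
  have "L \<in> fst ` ?N" unfolding L_def using N by (intro Max_in) auto
  then obtain n0 where n0: "(L, n0) \<in> K" "c (L, n0) \<noteq> 0" by auto
  have "rho (\<Sum>k\<in>K. con (c k) * fmon k) 1 = (\<Sum>k\<in>K. rho (con (c k) * fmon k) 1)"
    using K by (induction) (simp_all add: rho_add)
  then have "0 = Poly_Mapping.lookup (Poly_Mapping.lookup (\<Sum>k\<in>K. rho (con (c k) * fmon k) 1) (L, L, L)) n0"
    using rho_rel_ideal[OF rel_ideal, of 1] by simp
  also have "\<dots> = (\<Sum>k\<in>K. Poly_Mapping.lookup (Poly_Mapping.lookup (rho (con (c k) * fmon k) 1) (L, L, L)) n0)"
    by (simp add: lookup_sum)
  also have "\<dots> = (\<Sum>k\<in>K. if k = (L, n0) then c (L, n0) * q^(L*L) else 0)"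
  proof (rule sum.cong)
    fix k assume "k \<in> K"
    obtain l n where k: "k = (l, n)" by (cases k)
    show "Poly_Mapping.lookup (Poly_Mapping.lookup (rho (con (c k) * fmon k) 1) (L, L, L)) n0
        = (if k = (L, n0) then c (L, n0) * q^(L*L) else 0)"
    \<comment> \<open>Powers above \<open>L\<close> can occur in \<open>K\<close>, but only with
      coefficient 0; \<open>lookup_Om_power\<close> does not reach them.\<close>
    proof (cases "c k = 0")
      case True
      then show ?thesis using n0 by (auto simp: k rho_mult)
    next
      case False
      then have "l \<le> L" using L \<open>k \<in> K\<close> k by blast
      then have "Poly_Mapping.lookup ((Om ^^ l) 1) (L, L, L) = (if l = L then con (q^(L*L)) else 0)"
        by (simp add: lookup_Om_power)
      then have "Poly_Mapping.lookup (rho (con (c k) * fmon k) 1) (L, L, L)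
          = (if l = L then con (q^(L*L)) * Poly_Mapping.single n (c k) else 0)"
        unfolding k rho_fmon lookup_con_mult by (simp add: mult.commute)
      then show ?thesis by (auto simp: k lookup_con_mult lookup_single when_def)
    qed
  qed simp
  also have "\<dots> = c (L, n0) * q^(L*L)" using K n0 by simp
  finally show False using n0 q_nz by simp
qed

text \<open>Coefficients form a finitely supported function, so combinations add without merging
  index sets; its keys become the finite set in the theorem.\<close>

definition omega_sum :: "(nat \<times> idx \<Rightarrow>\<^sub>0 'a) \<Rightarrow> 'a fa" where
  "omega_sum = sum_extend (\<lambda>k c. con c * fmon k)"

lemma omega_sum_add: "omega_sum (g + h) = omega_sum g + omega_sum h"
  unfolding omega_sum_def by (rule sum_extend_add) (simp_all add: con_add algebra_simps)

lemma omega_sum_lift_scalar: "\<exists>g. omega_sum g = fOm q ^ n * lift_scalar r"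
proof (induction r rule: con_mon_induct)
  case (mon m c)
  have "omega_sum (Poly_Mapping.single (n, m) c) = fOm q ^ n * lift_scalar (con c * mon m)"
    by (simp add: omega_sum_def sum_extend_single lift_scalar_con_mon con_commute mult.assoc)
  then show ?case ..
next
  case (add v w)
  then show ?case by (metis lift_scalar_add omega_sum_add distrib_left)
qed

section \<open>Spanning\<close>

lemma con_eigen:
  fixes v :: "idx \<Rightarrow>\<^sub>0 'a"
  assumes "con c * v = con d * v" "c \<noteq> d"
  shows "v = 0"
proof (rule poly_mapping_eqI)
  fix n
  \<comment> \<open>\<open>c\<close> and \<open>d\<close> are field elements, so the cancellation
    happens in the field, coefficient by coefficient.\<close>
  have "c * Poly_Mapping.lookup v n = d * Poly_Mapping.lookup v n"
    using assms(1) by (metis lookup_con_mult)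
  then show "Poly_Mapping.lookup v n = Poly_Mapping.lookup 0 n" using assms(2) by simp
qed

lemma centre_top:
  assumes x: "x \<in> centre q" and low: "rho x 1 \<in> low (Suc (deg m))"
    and nz: "Poly_Mapping.lookup (rho x 1) m \<noteq> 0"
  shows "\<exists>n. m = (n, n, n)"
proof -
  obtain i j k where m: "m = (i, j, k)" by (cases m)
  \<comment> \<open>By \<open>rho_eq\<close> the left side is x g acting on \<open>1\<close>; the
    right side is g x.\<close>
  have comm: "lin (\<lambda>m. pbw_word m (gen_op g 1)) (rho x 1) = gen_op g (rho x 1)" for g
    using rho_cong[OF centreD[OF x, of "mon [g]"], of 1] by (simp add: rho_mult flip: rho_eq)
  let ?r = "Poly_Mapping.lookup (rho x 1) (i, j, k)"
  note top = commuting_top[OF low[unfolded m] comm[of GA, simplified] comm[of GB, simplified]]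
  have "con (q^(2*j) * inverse q^(2*k)) * ?r = con 1 * ?r"
    using top(1) by (simp add: con_mult con_power)
  then have "q^(2*j) * inverse q^(2*k) = 1" using con_eigen nz m by blast
  then have "q^(2*j) = q^(2*k)" using q_nz by (simp add: field_simps)
  then have jk: "j = k" using q_power_inj by fastforce
  have "con (q^(2*i)) * ?r = con (q^(2*k)) * ?r"
    using top(2) by (simp add: con_power)
  then have "q^(2*i) = q^(2*k)" using con_eigen nz m by blast
  then have "i = k" using q_power_inj by fastforce
  then show ?thesis using jk m by blast
qed

lemma centre_spanned:
  assumes "x \<in> centre q" "rho x 1 \<in> low d"
  shows "\<exists>g. cong q x (omega_sum g)"
  using assms
proof (induction d arbitrary: x)
  case 0
  then have "cong q x (omega_sum 0)" by (simp add: low_0 omega_sum_def cong_def rel_ideal_iff)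
  then show ?case ..
next
  case (Suc d)
  show ?case
  \<comment> \<open>By \<open>centre_top\<close> the part of degree \<open>d\<close> is supported at
    (n, n, n) with 3n = d, so it vanishes unless 3 divides \<open>d\<close>.\<close>
  proof (cases "\<exists>n. d = 3 * n")
    case False
    have "rho x 1 \<in> low d"
    proof (rule lowI, rule ccontr)
      fix m assume m: "d \<le> deg m" "Poly_Mapping.lookup (rho x 1) m \<noteq> 0"
      then have "deg m = d" using low_lookup[OF Suc.prems(2)] by (metis le_antisym not_less_eq_eq)
      then obtain l where "m = (l, l, l)"
        using centre_top[OF Suc.prems(1), of m] Suc.prems(2) m by auto
      then have "d = 3 * l" using \<open>deg m = d\<close> by simp
      then show False using False by blast
    qed
    then show ?thesis using Suc by blast
  next
    case True
    then obtain n where d: "d = 3 * n" by blast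
    \<comment> \<open>The leading coefficient q^(n^2) of \<Omega>^n is a unit, so an R-multiple of
      \<Omega>^n can match the top coefficient of \<open>x\<close>.\<close>
    define r where "r = con (inverse (q^(n*n))) * Poly_Mapping.lookup (rho x 1) (n, n, n)"
    have r: "r * con (q^(n*n)) = Poly_Mapping.lookup (rho x 1) (n, n, n)"
      using q_nz by (simp add: r_def mult.commute flip: mult.assoc con_mult)
    define y where "y = x - fOm q ^ n * lift_scalar r"
    have y: "rho y 1 = rho x 1 - con r * (Om ^^ n) 1"
      by (simp add: y_def rho_diff rho_mult rho_lift_scalar rho_fOm_power Om_power_con flip: mult_1_right)
    have "rho y 1 \<in> low d"
    proof (rule lowI)
      fix m assume dm: "d \<le> deg m"
      have Om: "Poly_Mapping.lookup ((Om ^^ n) 1) m = (if m = (n, n, n) then con (q^(n*n)) else 0)"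
        using dm d by (intro lookup_Om_power) simp
      show "Poly_Mapping.lookup (rho y 1) m = 0"
      proof (cases "m = (n, n, n)")
        case True
        then show ?thesis using Om r by (simp add: y lookup_minus lookup_con_mult)
      next
        case False
        have "Poly_Mapping.lookup (rho x 1) m = 0"
        proof (rule ccontr)
          assume nz: "Poly_Mapping.lookup (rho x 1) m \<noteq> 0"
          then have "deg m = d" using low_lookup[OF Suc.prems(2)] dm by (metis le_antisym not_less_eq_eq)
          moreover obtain l where "m = (l, l, l)"
            using centre_top[OF Suc.prems(1), of m] Suc.prems(2) nz \<open>deg m = d\<close> by auto
          ultimately show False using False d by simp
        qed
        then show ?thesis using Om False by (simp add: y lookup_minus lookup_con_mult)
      qed
    qed
    moreover have "y \<in> centre q"
      unfolding y_def using Suc.prems by (intro centre_diff centre_mult centre_power centre_fOm centre_lift_scalar)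
    ultimately obtain g where g: "cong q y (omega_sum g)" using Suc.IH by blast
    obtain h where h: "omega_sum h = fOm q ^ n * lift_scalar r" using omega_sum_lift_scalar by blast
    have "cong q (y + omega_sum h) (omega_sum g + omega_sum h)" using g by (intro cong_add) simp_all
    then have "cong q x (omega_sum (g + h))" by (simp add: omega_sum_add h y_def)
    then show ?thesis ..
  qed
qed

end

theorem theorem8p2:
  fixes q :: "'a::field"
  assumes "q \<noteq> 0" and "q ^ 4 \<noteq> 1"
    and "\<forall>n::nat. n > 0 \<longrightarrow> q ^ n \<noteq> 1"
  shows "(\<forall>k. aw_central q (aw_mon q k))
       \<and> (\<forall>S c. finite S \<longrightarrow> aw_lincomb q c S \<in> aw_ideal q \<longrightarrow> (\<forall>k\<in>S. c k = 0))
       \<and> (\<forall>x. aw_central q x \<longrightarrow>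
            (\<exists>S c. finite S \<and> ncsub x (aw_lincomb q c S) \<in> aw_ideal q))"
proof -
  interpret askey_wilson q using assms by unfold_locales auto
  have "aw_central q (aw_mon q k)" for k
    using centre_fmon[of k] by (simp add: lookup_fmon_idx flip: aw_central_lookup)
  moreover have "c k = 0" if "finite K" "aw_lincomb q c K \<in> aw_ideal q" "k \<in> K" for K c k
    using fmon_independent[OF that(1) _ that(3)] that(2) by (simp add: rel_ideal_def lookup_lincomb)
  moreover have "\<exists>K c. finite K \<and> ncsub x (aw_lincomb q c K) \<in> aw_ideal q" if central: "aw_central q x" for x
  proof -
    obtain x' where x: "x = Poly_Mapping.lookup x'"
      using central ncpolys_lookup unfolding aw_central_def by blast
    then have "x' \<in> centre q" using central by (simp add: aw_central_lookup)
    then obtain g where "cong q x' (omega_sum g)" using centre_spanned low_exists by blast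
    then have "Poly_Mapping.lookup (x' - (\<Sum>k\<in>Poly_Mapping.keys g. con (Poly_Mapping.lookup g k) * fmon k)) \<in> aw_ideal q"
      by (simp add: cong_def rel_ideal_def omega_sum_def sum_extend_def)
    then have "ncsub x (aw_lincomb q (Poly_Mapping.lookup g) (Poly_Mapping.keys g)) \<in> aw_ideal q"
      by (simp only: lookup_fa_diff lookup_lincomb x)
    then show ?thesis using finite_keys by blast
  qed
  ultimately show ?thesis by blast
qed

end
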